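(* Let $K$ be any field, $R$ a $K$-algebra, and $J$ an ideal of $R$. If $J$ is locally f.d.ss and $R/J$ is locally matricial, then $R$ is locally f.d.ss.
   Context: All algebras are associative but not necessarily unital $K$-algebras; ideals are two-sided ring ideals that are also $K$-subspaces. A $K$-algebra $R$ is locally f.d.ss if every finite subset of $R$ is contained in a subalgebra of $R$ that is a finite dimensional semisimple $K$-algebra. A $K$-algebra is matricial if it is isomorphic to $\prod_{i=1}^k M_{n_i}(K)$ for positive integers $n_i$; it is locally matricial if every finite subset is contained in a matricial subalgebra. *)

theory Defs
  imports Main
begin

record ('k, 'a) kalg =
  acarrier :: "'a set"
  azero :: 'a
  aadd :: "'a \<Rightarrow> 'a \<Rightarrow> 'a"
  aneg :: "'a \<Rightarrow> 'a"
  amul :: "'a \<Rightarrow> 'a \<Rightarrow> 'a"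
  asmul :: "'k \<Rightarrow> 'a \<Rightarrow> 'a"

definition is_kalg :: "('k::field, 'a, 'b) kalg_scheme \<Rightarrow> bool" where
  "is_kalg A \<longleftrightarrow>
    (let C = acarrier A; p = aadd A; m = amul A; s = asmul A; z = azero A; n = aneg A in
      z \<in> C \<and> (\<forall>x\<in>C. \<forall>y\<in>C. p x y \<in> C \<and> m x y \<in> C) \<and> (\<forall>x\<in>C. n x \<in> C)
      \<and> (\<forall>c. \<forall>x\<in>C. s c x \<in> C)
      \<and> (\<forall>x\<in>C. \<forall>y\<in>C. \<forall>w\<in>C. p (p x y) w = p x (p y w) \<and> m (m x y) w = m x (m y w)
            \<and> m x (p y w) = p (m x y) (m x w) \<and> m (p x y) w = p (m x w) (m y w))
      \<and> (\<forall>x\<in>C. \<forall>y\<in>C. p x y = p y x)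
      \<and> (\<forall>x\<in>C. p z x = x \<and> p (n x) x = z)
      \<and> (\<forall>c d. \<forall>x\<in>C. \<forall>y\<in>C. s c (p x y) = p (s c x) (s c y) \<and> s (c + d) x = p (s c x) (s d x)
            \<and> s (c * d) x = s c (s d x) \<and> s 1 x = x
            \<and> s c (m x y) = m (s c x) y \<and> s c (m x y) = m x (s c y)))"

definition kalg_subalgebra :: "'a set \<Rightarrow> ('k, 'a, 'b) kalg_scheme \<Rightarrow> bool" where
  "kalg_subalgebra S A \<longleftrightarrow> S \<subseteq> acarrier A \<and> azero A \<in> S
     \<and> (\<forall>x\<in>S. \<forall>y\<in>S. aadd A x y \<in> S \<and> amul A x y \<in> S)
     \<and> (\<forall>x\<in>S. aneg A x \<in> S) \<and> (\<forall>c. \<forall>x\<in>S. asmul A c x \<in> S)"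

definition kalg_ideal :: "'a set \<Rightarrow> ('k, 'a, 'b) kalg_scheme \<Rightarrow> bool" where
  "kalg_ideal J A \<longleftrightarrow> J \<subseteq> acarrier A \<and> azero A \<in> J
     \<and> (\<forall>x\<in>J. \<forall>y\<in>J. aadd A x y \<in> J) \<and> (\<forall>x\<in>J. aneg A x \<in> J)
     \<and> (\<forall>c. \<forall>x\<in>J. asmul A c x \<in> J)
     \<and> (\<forall>x\<in>acarrier A. \<forall>j\<in>J. amul A x j \<in> J \<and> amul A j x \<in> J)"

inductive_set kspan :: "('k, 'a, 'b) kalg_scheme \<Rightarrow> 'a set \<Rightarrow> 'a set" for A B where
  kspan_zero: "azero A \<in> kspan A B"
| kspan_gen: "b \<in> B \<Longrightarrow> b \<in> kspan A B"
| kspan_add: "x \<in> kspan A B \<Longrightarrow> y \<in> kspan A B \<Longrightarrow> aadd A x y \<in> kspan A B"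
| kspan_smul: "x \<in> kspan A B \<Longrightarrow> asmul A c x \<in> kspan A B"

definition fin_dim :: "('k, 'a, 'b) kalg_scheme \<Rightarrow> bool" where
  "fin_dim A \<longleftrightarrow> (\<exists>B. finite B \<and> B \<subseteq> acarrier A \<and> acarrier A \<subseteq> kspan A B)"

text \<open>Jacobson radical of a (possibly non-unital) ring: a is left quasi-regular if
b + a + b a = 0 for some b; J(A) = {a. r a is left quasi-regular for all r}.\<close>
definition left_qr :: "('k, 'a, 'b) kalg_scheme \<Rightarrow> 'a \<Rightarrow> bool" where
  "left_qr A a \<longleftrightarrow> (\<exists>b\<in>acarrier A. aadd A (aadd A b a) (amul A b a) = azero A)"

definition jacobson_rad :: "('k, 'a, 'b) kalg_scheme \<Rightarrow> 'a set" where
  "jacobson_rad A = {a \<in> acarrier A. \<forall>r\<in>acarrier A. left_qr A (amul A r a)}"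

definition fdss :: "('k::field, 'a, 'b) kalg_scheme \<Rightarrow> bool" where
  "fdss A \<longleftrightarrow> is_kalg A \<and> fin_dim A \<and> jacobson_rad A = {azero A}"

definition locally_fdss :: "('k::field, 'a, 'b) kalg_scheme \<Rightarrow> bool" where
  "locally_fdss A \<longleftrightarrow> (\<forall>F. finite F \<and> F \<subseteq> acarrier A \<longrightarrow>
     (\<exists>S. kalg_subalgebra S A \<and> F \<subseteq> S \<and> fdss (A\<lparr>acarrier := S\<rparr>)))"

text \<open>The algebra prod_{i<k} M_{n i}(K): element f i r c is entry (r,c) of component i.\<close>
definition mat_alg :: "nat \<Rightarrow> (nat \<Rightarrow> nat) \<Rightarrow> ('k::field, nat \<Rightarrow> nat \<Rightarrow> nat \<Rightarrow> 'k) kalg" where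
  "mat_alg k n = \<lparr>acarrier = {f. \<forall>i r c. (k \<le> i \<or> n i \<le> r \<or> n i \<le> c) \<longrightarrow> f i r c = 0},
     azero = (\<lambda>i r c. 0),
     aadd = (\<lambda>f g i r c. f i r c + g i r c),
     aneg = (\<lambda>f i r c. - f i r c),
     amul = (\<lambda>f g i r c. \<Sum>j<n i. f i r j * g i j c),
     asmul = (\<lambda>a f i r c. a * f i r c)\<rparr>"

definition kalg_iso :: "('k, 'a, 'b) kalg_scheme \<Rightarrow> ('k, 'c, 'd) kalg_scheme \<Rightarrow> ('a \<Rightarrow> 'c) \<Rightarrow> bool" where
  "kalg_iso A B h \<longleftrightarrow> bij_betw h (acarrier A) (acarrier B)
     \<and> (\<forall>x\<in>acarrier A. \<forall>y\<in>acarrier A. h (aadd A x y) = aadd B (h x) (h y)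
                                        \<and> h (amul A x y) = amul B (h x) (h y))
     \<and> (\<forall>c. \<forall>x\<in>acarrier A. h (asmul A c x) = asmul B c (h x))"

definition matricial :: "('k::field, 'a, 'b) kalg_scheme \<Rightarrow> bool" where
  "matricial A \<longleftrightarrow> is_kalg A \<and>
     (\<exists>k n h. (\<forall>i<k. 0 < n i) \<and> kalg_iso A (mat_alg k n :: ('k, nat \<Rightarrow> nat \<Rightarrow> nat \<Rightarrow> 'k) kalg) h)"

definition locally_matricial :: "('k::field, 'a, 'b) kalg_scheme \<Rightarrow> bool" where
  "locally_matricial A \<longleftrightarrow> (\<forall>F. finite F \<and> F \<subseteq> acarrier A \<longrightarrow>
     (\<exists>S. kalg_subalgebra S A \<and> F \<subseteq> S \<and> matricial (A\<lparr>acarrier := S\<rparr>)))"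

definition kcoset :: "('k, 'a, 'b) kalg_scheme \<Rightarrow> 'a set \<Rightarrow> 'a \<Rightarrow> 'a set" where
  "kcoset A J x = {aadd A x j | j. j \<in> J}"

definition quot_alg :: "('k, 'a, 'b) kalg_scheme \<Rightarrow> 'a set \<Rightarrow> ('k, 'a set) kalg" where
  "quot_alg A J = (let rep = (\<lambda>X. SOME x. x \<in> X) in
     \<lparr>acarrier = kcoset A J ` acarrier A,
      azero = kcoset A J (azero A),
      aadd = (\<lambda>X Y. kcoset A J (aadd A (rep X) (rep Y))),
      aneg = (\<lambda>X. kcoset A J (aneg A (rep X))),
      amul = (\<lambda>X Y. kcoset A J (amul A (rep X) (rep Y))),
      asmul = (\<lambda>c X. kcoset A J (asmul A c (rep X)))\<rparr>)"

end

theory Submission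
  imports Defs "HOL.Vector_Spaces" "HOL-Library.Poly_Mapping" "HOL-Algebra.FiniteProduct"
begin

text \<open>A finite-dimensional algebra is semisimple iff it is von Neumann regular, so \<open>J\<close> is a regular
ideal. Regularity of \<open>J\<close> allows the matrix units of a matricial subalgebra of \<open>R/J\<close> to be lifted to
genuine matrix units of \<open>R\<close>, at the cost of shrinking the diagonal idempotents by idempotents of \<open>J\<close>.
Given finitely many elements of \<open>R\<close>, shrinking further produces an idempotent \<open>e \<in> J\<close> orthogonal to the
lifted units such that each given element is a combination of the units plus an element of \<open>eJe\<close>.
A finite-dimensional semisimple \<open>T \<subseteq> eJe\<close> containing these elements of \<open>eJe\<close> then annihilates the span
\<open>M\<close> of the units on both sides, so \<open>T + M\<close> is a finite-dimensional regular algebra.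

To calculate in a type with ring operations instead of a carrier, \<open>R\<close> is embedded into the linear
endomorphisms of a vector space that contains the unitization of \<open>R\<close> as a direct summand.\<close>

section \<open>Semisimplicity and von Neumann regularity\<close>

text \<open>Regularity is an elementwise condition, so it passes to the possibly
  infinite-dimensional \<open>J\<close> and to its corners, where finite-dimensional semisimplicity
  has no direct meaning. The main obstacle is that a finite-dimensional part of \<open>J\<close>
  need not be stable under multiplication by the lifted units. The idempotent e is therefore chosen
  to commute with all of them: it is a block-scalar matrix, with one idempotent of \<open>J\<close>
  per block repeated along the diagonal, and the units are then multiplied by 1 - e. This may
  annihilate some units, so their span is handled through its multiplication table and never
  identified with a full matrix algebra. The quotient being matricial matters because matrix units
  satisfy a finite table of relations with coefficients 0 and 1; lifting the table lifts the
  algebra, whereas a block over a division algebra would also require lifting that division algebra.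
  Complements such as 1 - u need a unit, which \<open>R\<close> may lack. They are formed in the
  ambient ring, inside the idealizer of \<open>J\<close>, so membership of the final algebra in
  \<open>R\<close> has to be recovered afterwards.\<close>

locale kalgebra = vector_space scale
  for scale :: "'k::field \<Rightarrow> 'r::ring_1 \<Rightarrow> 'r" (infixr "*s" 75) +
  assumes scale_mult_left: "(c *s x) * y = c *s (x * y)"
    and scale_mult_right: "x * (c *s y) = c *s (x * y)"

definition vn_regular :: "'r::ring_1 set \<Rightarrow> bool" where
  "vn_regular S \<longleftrightarrow> (\<forall>a\<in>S. \<exists>y\<in>S. a * y * a = a)"

context kalgebra
begin

definition subalg :: "'r set \<Rightarrow> bool" where
  "subalg S \<longleftrightarrow> subspace S \<and> (\<forall>x\<in>S. \<forall>y\<in>S. x * y \<in> S)"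

definition findim :: "'r set \<Rightarrow> bool" where
  "findim S \<longleftrightarrow> (\<exists>B. finite B \<and> S \<subseteq> span B)"

definition radical_free :: "'r set \<Rightarrow> bool" where
  "radical_free S \<longleftrightarrow>
     (\<forall>a\<in>S. (\<forall>r\<in>S. \<exists>b\<in>S. b + r * a + b * (r * a) = 0) \<longrightarrow> a = 0)"

lemma subalg_0: "subalg S \<Longrightarrow> 0 \<in> S"
  and subalg_add: "subalg S \<Longrightarrow> x \<in> S \<Longrightarrow> y \<in> S \<Longrightarrow> x + y \<in> S"
  and subalg_diff: "subalg S \<Longrightarrow> x \<in> S \<Longrightarrow> y \<in> S \<Longrightarrow> x - y \<in> S"
  and subalg_neg: "subalg S \<Longrightarrow> x \<in> S \<Longrightarrow> - x \<in> S"
  and subalg_scale: "subalg S \<Longrightarrow> x \<in> S \<Longrightarrow> c *s x \<in> S"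
  and subalg_mult: "subalg S \<Longrightarrow> x \<in> S \<Longrightarrow> y \<in> S \<Longrightarrow> x * y \<in> S"
  by (auto simp: subalg_def subspace_0 subspace_add subspace_diff subspace_neg subspace_scale)

lemmas subalg_closed = subalg_0 subalg_add subalg_diff subalg_neg subalg_scale subalg_mult

text \<open>A polynomial relation for \<open>x\<close> without constant term, solved for its lowest
  power. Positive powers of \<open>x\<close> lie in \<open>S\<close>, which may lack a unit, and
  they cannot be independent once their number exceeds the size of a spanning set.\<close>

lemma power_in_span_higher_powers:
  assumes "subalg S" "findim S" "x \<in> S"
  shows "\<exists>k>0. x ^ k \<in> span ((\<lambda>j. x ^ j) ` {k<..})"
proof (rule ccontr)
  assume neg: "\<not> ?thesis"
  obtain B where B: "finite B" "S \<subseteq> span B"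
    using assms(2) by (auto simp: findim_def)
  define N where "N = Suc (card B)"
  have xS: "x ^ Suc j \<in> S" for j
    by (induction j) (use assms in \<open>auto intro: subalg_closed\<close>)
  \<comment> \<open>Powers are added from the top downwards, because the assumed failure says that
    each one lies outside the span of the higher ones. That also makes them distinct, hence the
    cardinality.\<close>
  have "independent ((\<lambda>j. x ^ j) ` {N - d<..N}) \<and> card ((\<lambda>j. x ^ j) ` {N - d<..N}) = d"
    if "d \<le> N" for d
    using that
  proof (induction d)
    case 0
    then show ?case by (simp add: independent_empty)
  next
    case (Suc d)
    let ?A = "(\<lambda>j. x ^ j) ` {N - d<..N}"
    have "{N - Suc d<..N} = insert (N - d) {N - d<..N}" using Suc.prems by auto
    then have eq: "(\<lambda>j. x ^ j) ` {N - Suc d<..N} = insert (x ^ (N - d)) ?A" by simp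
    have "N - d > 0" using Suc.prems by simp
    then have "x ^ (N - d) \<notin> span ((\<lambda>j. x ^ j) ` {N - d<..})" using neg by blast
    moreover have "span ?A \<subseteq> span ((\<lambda>j. x ^ j) ` {N - d<..})"
      by (intro span_mono) auto
    ultimately have notin: "x ^ (N - d) \<notin> span ?A" by blast
    then have "x ^ (N - d) \<notin> ?A" using span_base by blast
    with notin show ?case using Suc unfolding eq by (simp add: independent_insertI)
  qed
  from this[of N] have "independent ((\<lambda>j. x ^ j) ` {0<..N})" "card ((\<lambda>j. x ^ j) ` {0<..N}) = N"
    by auto
  moreover have "(\<lambda>j. x ^ j) ` {0<..N} \<subseteq> span B"
  proof clarsimp
    fix j :: nat assume "0 < j"
    then obtain i where "j = Suc i" using gr0_implies_Suc by blast
    then show "x ^ j \<in> span B" using xS[of i] B(2) by blast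
  qed
  ultimately show False using independent_span_bound[OF B(1)] N_def by fastforce
qed

text \<open>Fitting's lemma for multiplication by \<open>x\<close>. From
  \<open>x ^ k = x ^ Suc k * q\<close>, with \<open>q\<close> commuting with \<open>x\<close>, the
  element \<open>x ^ k * q ^ k\<close> is the projection onto the part where \<open>x\<close> is
  invertible. The last equation says that \<open>x\<close> is nilpotent on the complement
  \<open>1 - f\<close>, and \<open>f = g * x\<close> places \<open>f\<close> in the left ideal
  generated by \<open>x\<close>.\<close>

lemma fitting_idempotent:
  assumes S: "subalg S" "findim S" and x: "x \<in> S"
  shows "\<exists>f g k. f \<in> S \<and> g \<in> S \<and> f * f = f \<and> f = g * x \<and> 0 < k \<and> x ^ k * f = x ^ k"
proof -
  obtain k where k: "k > 0" "x ^ k \<in> span ((\<lambda>j. x ^ j) ` {k<..})"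
    using power_in_span_higher_powers[OF assms] by blast
  \<comment> \<open>\<open>Q\<close> replaces the polynomials in \<open>x\<close>: it contains
    \<open>1\<close> and \<open>x\<close>, although \<open>1\<close> need not be in
    \<open>S\<close>, and right multiplication by its elements preserves \<open>S\<close>.\<close>
  define Q where "Q = {q. q * x = x * q \<and> (\<forall>s\<in>S. s * q \<in> S)}"
  have Q_mult: "p * q \<in> Q" if "p \<in> Q" "q \<in> Q" for p q
    using that unfolding Q_def by (auto simp: mult.assoc[symmetric]) (metis mult.assoc)
  have Q_space: "subspace Q"
    unfolding Q_def subspace_def
    using S(1) by (auto simp: subalg_closed scale_mult_left scale_mult_right algebra_simps)
  have "1 \<in> Q" "x \<in> Q" using S x by (auto simp: Q_def subalg_mult)
  then have Q_power: "q ^ n \<in> Q" if "q \<in> Q" for q n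
    by (induction n) (use that in \<open>auto intro: Q_mult\<close>)
  have "subspace ((\<lambda>q. x ^ Suc k * q) ` Q)"
  proof (rule subspaceI)
    show "0 \<in> (\<lambda>q. x ^ Suc k * q) ` Q"
      using subspace_0[OF Q_space] by (auto intro!: image_eqI[where x=0])
  next
    fix u v assume "u \<in> (\<lambda>q. x ^ Suc k * q) ` Q" "v \<in> (\<lambda>q. x ^ Suc k * q) ` Q"
    then obtain p q where "p \<in> Q" "q \<in> Q" "u = x ^ Suc k * p" "v = x ^ Suc k * q" by blast
    then show "u + v \<in> (\<lambda>q. x ^ Suc k * q) ` Q"
      using subspace_add[OF Q_space, of p q] by (auto intro!: image_eqI[where x="p + q"] simp: distrib_left)
  next
    fix c u assume "u \<in> (\<lambda>q. x ^ Suc k * q) ` Q"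
    then obtain p where "p \<in> Q" "u = x ^ Suc k * p" by blast
    then show "c *s u \<in> (\<lambda>q. x ^ Suc k * q) ` Q"
      using subspace_scale[OF Q_space, of p c]
      by (auto intro!: image_eqI[where x="c *s p"] simp: scale_mult_right)
  qed
  moreover have "(\<lambda>j. x ^ j) ` {k<..} \<subseteq> (\<lambda>q. x ^ Suc k * q) ` Q"
  proof clarify
    fix j assume "k < j"
    then have "x ^ j = x ^ Suc k * x ^ (j - Suc k)" by (metis Suc_leI le_add_diff_inverse power_add)
    then show "x ^ j \<in> (\<lambda>q. x ^ Suc k * q) ` Q" using Q_power \<open>x \<in> Q\<close> by blast
  qed
  ultimately have "span ((\<lambda>j. x ^ j) ` {k<..}) \<subseteq> (\<lambda>q. x ^ Suc k * q) ` Q"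
    using span_minimal by blast
  then obtain q where q: "q \<in> Q" "x ^ k = x ^ Suc k * q" using k by blast
  have red: "x ^ k = x ^ m * x ^ k * q ^ m" for m
  proof (induction m)
    case (Suc m)
    have "x ^ Suc m * x ^ k * q ^ Suc m = x ^ m * (x ^ Suc k * q) * q ^ m"
      by (subst power_Suc2, subst power_Suc) (simp add: mult.assoc)
    also have "\<dots> = x ^ m * x ^ k * q ^ m" by (simp only: q(2)[symmetric])
    finally show ?case using Suc.IH by (rule subst[OF sym])
  qed simp
  define f where "f = x ^ k * q ^ k"
  have qx: "q ^ k * x = x * q ^ k" using q Q_power unfolding Q_def by blast
  have qxk: "q ^ k * x ^ k = x ^ k * q ^ k" using power_commuting_commutes[of x "q ^ k"] qx by metis
  have "x ^ k \<in> S" using \<open>k > 0\<close> 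
  proof (induction k)
    case (Suc k) then show ?case by (cases k) (use S x in \<open>auto intro: subalg_closed\<close>)
  qed simp
  then have fS: "f \<in> S" unfolding f_def using Q_power[OF q(1)] by (auto simp: Q_def)
  have xf: "x ^ k * f = x ^ k" unfolding f_def using red[of k] by (simp add: mult.assoc)
  have ff: "f * f = f"
  proof -
    have "f * f = x ^ k * (q ^ k * x ^ k) * q ^ k" unfolding f_def by (simp add: mult.assoc)
    also have "\<dots> = (x ^ k * x ^ k * q ^ k) * q ^ k" unfolding qxk by (simp add: mult.assoc)
    finally show ?thesis unfolding f_def using red[of k] by simp
  qed
  \<comment> \<open>The factor \<open>f\<close> on the left keeps \<open>g\<close> in
    \<open>S\<close> even when \<open>k = 1\<close>, where \<open>x ^ (k - 1)\<close> is the ambient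
    unit.\<close>
  define g where "g = f * (x ^ (k - 1) * q ^ k)"
  have "g \<in> S"
    using fS Q_mult[OF Q_power[OF \<open>x \<in> Q\<close>] Q_power[OF q(1)]] unfolding g_def by (auto simp: Q_def)
  moreover have "f = g * x"
  proof -
    have "g * x = f * (x ^ (k - 1) * x * q ^ k)" unfolding g_def by (simp add: mult.assoc qx)
    also have "x ^ (k - 1) * x = x ^ k" using \<open>k > 0\<close> by (metis power_minus_mult)
    finally show ?thesis using ff f_def by simp
  qed
  ultimately show ?thesis using fS ff xf \<open>k > 0\<close> by blast
qed

text \<open>Left quasi-regularity of \<open>x\<close> means \<open>(1 + b) * (1 + x) = 1\<close>, so
  a finite geometric series in \<open>- x\<close> without its constant term serves as
  \<open>b\<close>.\<close>

lemma nilpotent_left_quasi_regular: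
  assumes S: "subalg S" and x: "x \<in> S" and nil: "x ^ k = 0" "0 < k"
  shows "\<exists>b\<in>S. b + x + b * x = 0"
proof -
  have "\<exists>b\<in>S. (1 + b) * (1 + x) = 1 - (- x) ^ Suc n" for n
  proof (induction n)
    case 0
    then show ?case using S by (intro bexI[of _ 0]) (auto simp: subalg_0)
  next
    case (Suc n)
    then obtain b where b: "b \<in> S" "(1 + b) * (1 + x) = 1 - (- x) ^ Suc n" by blast
    have p: "(- x) ^ Suc m \<in> S" for m
    proof (induction m)
      case (Suc m)
      then show ?case using subalg_mult[OF S subalg_neg[OF S x]] by (metis power_Suc)
    qed (use S x subalg_neg in simp)
    have "(1 + (b + (- x) ^ Suc n)) * (1 + x) = (1 + b) * (1 + x) + (- x) ^ Suc n * (1 + x)"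
      by (simp add: algebra_simps)
    also have "(- x) ^ Suc n * (1 + x) = (- x) ^ Suc n - (- x) ^ Suc (Suc n)"
      using power_Suc2[of "- x" "Suc n"] by (simp only: distrib_left mult_1_right mult_minus_right diff_minus_eq_add)
    also have "(1 + b) * (1 + x) + ((- x) ^ Suc n - (- x) ^ Suc (Suc n)) = 1 - (- x) ^ Suc (Suc n)"
      unfolding b(2) by simp
    finally show ?case using subalg_add[OF S b(1) p[of n]] by blast
  qed
  then obtain b where b: "b \<in> S" "(1 + b) * (1 + x) = 1 - (- x) ^ Suc (k - 1)" by blast
  have "(- x) ^ Suc (k - 1) = 0"
    using nil by (simp add: power_minus[of x])
  then have "b + x + b * x = 0" using b(2) by (simp add: algebra_simps)
  then show ?thesis using b(1) by blast
qed

text \<open>If \<open>a\<close> is outside the radical, some \<open>r * a\<close> is not left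
  quasi-regular, hence not nilpotent, so its Fitting idempotent is nonzero.\<close>

lemma radical_free_nonzero_idempotent:
  assumes S: "subalg S" "findim S" "radical_free S" and a: "a \<in> S" "a \<noteq> 0"
  shows "\<exists>f s. s \<in> S \<and> f = s * a \<and> f * f = f \<and> f \<noteq> 0"
proof -
  obtain r where r: "r \<in> S" "\<not> (\<exists>b\<in>S. b + r * a + b * (r * a) = 0)"
    using S(3) a unfolding radical_free_def by blast
  have ra: "r * a \<in> S" using S r a subalg_mult by blast
  obtain f g k where f: "g \<in> S" "f * f = f" "f = g * (r * a)" "0 < k" "(r * a) ^ k * f = (r * a) ^ k"
    using fitting_idempotent[OF S(1,2) ra] by blast
  have "f \<noteq> 0"
  proof
    assume "f = 0"
    then have "(r * a) ^ k = 0" using f by simp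
    then show False using nilpotent_left_quasi_regular[OF S(1) ra] f(4) r by blast
  qed
  then show ?thesis using f S(1) r(1) subalg_mult by (intro exI[of _ f] exI[of _ "g * r"]) (simp add: mult.assoc)
qed

lemma dim_less_of_new_element:
  assumes "findim V" "subspace U" "U \<subseteq> V" "g \<in> V" "g \<notin> U"
  shows "dim U < dim V"
proof -
  obtain C where C: "C \<subseteq> U" "independent C" "U \<subseteq> span C" "card C = dim U"
    using basis_exists by blast
  obtain D where D: "D \<subseteq> V" "independent D" "V \<subseteq> span D" "card D = dim V"
    using basis_exists by blast
  obtain B where B: "finite B" "V \<subseteq> span B"
    using assms(1) by (auto simp: findim_def)
  have "finite D" using independent_span_bound[OF B(1) D(2)] D(1) B(2) by blast
  have g: "g \<notin> span C" using C assms(2,5) span_minimal by blast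
  then have "independent (insert g C)" using C by (simp add: independent_insertI)
  then have "finite (insert g C) \<and> card (insert g C) \<le> card D"
    using independent_span_bound[OF \<open>finite D\<close>] C D assms by blast
  moreover have "g \<notin> C" using g span_base by blast
  ultimately show ?thesis using C(4) D(4) by (auto simp: card_insert_if)
qed

text \<open>The left ideal \<open>S a\<close> is generated by an idempotent. Choose an idempotent
  \<open>f\<close> in it with \<open>S f\<close> of largest dimension; if \<open>a\<close> differed
  from \<open>a * f\<close>, an idempotent from the left ideal of the remainder could be joined to
  \<open>f\<close>. Writing \<open>f = s * a\<close> then gives
  \<open>a = a * s * a\<close>.\<close>

theorem radical_free_imp_vn_regular:
  assumes S: "subalg S" "findim S" "radical_free S"
  shows "vn_regular S"
  unfolding vn_regular_def
proof
  fix a assume a: "a \<in> S"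
  \<comment> \<open>For an idempotent \<open>f\<close> in \<open>S\<close> this is the left ideal
    \<open>S f\<close>, whose dimension measures \<open>f\<close>.\<close>
  define fixed where "fixed f = {t \<in> S. t * f = t}" for f
  have fixed_space: "subspace (fixed f)" for f
    unfolding fixed_def subspace_def using S(1)
    by (auto simp: subalg_closed scale_mult_left algebra_simps)
  obtain B where B: "finite B" "S \<subseteq> span B"
    using S(2) by (auto simp: findim_def)
  define P where "P f \<longleftrightarrow> f * f = f \<and> (\<exists>s\<in>S. f = s * a)" for f
  have "P 0" unfolding P_def using S(1) subalg_0 by force
  moreover have bound: "dim (fixed f) < Suc (card B)" for f
    using dim_le_card[of "fixed f" B] B unfolding fixed_def by fastforce
  ultimately obtain f where f: "P f" "\<And>h. P h \<Longrightarrow> dim (fixed h) \<le> dim (fixed f)"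
    using ex_has_greatest_nat[of P 0 "\<lambda>f. dim (fixed f)" "Suc (card B)"] by (metis less_imp_le)
  then obtain s where s: "f * f = f" "s \<in> S" "f = s * a" by (auto simp: P_def)
  have fS: "f \<in> S" using s S a subalg_mult by blast
  have "a = a * f"
  proof (rule ccontr)
    assume "a \<noteq> a * f"
    then have "a - a * f \<noteq> 0" "a - a * f \<in> S" using S(1) a fS by (auto simp: subalg_closed)
    then obtain g t where g: "t \<in> S" "g = t * (a - a * f)" "g * g = g" "g \<noteq> 0"
      using radical_free_nonzero_idempotent[OF S] by metis
    have gS: "g \<in> S" using g \<open>a - a * f \<in> S\<close> S(1) subalg_mult by blast
    have gf: "g * f = 0" unfolding g(2) using s(1) by (simp add: algebra_simps)
    \<comment> \<open>As \<open>g * f = 0\<close>, this is an idempotent whose left ideal contains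
      both \<open>f\<close> and \<open>g\<close>: right multiplication by \<open>h\<close> fixes
      each of them.\<close>
    define h where "h = f + g - f * g"
    have hf: "h * f = f" unfolding h_def by (simp add: algebra_simps s(1) gf mult.assoc)
    have hg: "h * g = g" unfolding h_def by (simp add: algebra_simps g(3) mult.assoc)
    have hh: "h * h = h"
    proof -
      have "h * h = h * f + h * g - h * f * g"
        by (subst (2) h_def) (simp add: algebra_simps)
      then show ?thesis using hf hg by (simp add: h_def)
    qed
    have fh: "f * h = f" unfolding h_def by (simp add: algebra_simps s(1) mult.assoc[symmetric])
    have gh: "g * h = g" unfolding h_def by (simp add: algebra_simps g(3) gf mult.assoc[symmetric])
    have g': "g = (t - t * a * s) * a" using g(2) s(3) by (simp add: algebra_simps)
    have "h = (s + (t - t * a * s) - f * (t - t * a * s)) * a"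
    proof -
      have "h = s * a + (t - t * a * s) * a - f * ((t - t * a * s) * a)"
        unfolding h_def g'[symmetric] s(3)[symmetric] by simp
      then show ?thesis by (simp add: algebra_simps)
    qed
    moreover have "s + (t - t * a * s) - f * (t - t * a * s) \<in> S"
      using S(1) s g a fS by (auto intro!: subalg_closed)
    ultimately have "P h" using hh unfolding P_def by blast
    have sub: "fixed f \<subseteq> fixed h" unfolding fixed_def by clarify (metis fh mult.assoc)
    have "findim (fixed h)" using S(2) unfolding findim_def fixed_def by blast
    moreover have "g \<in> fixed h" "g \<notin> fixed f" using gS gh gf g(4) by (auto simp: fixed_def)
    ultimately have "dim (fixed f) < dim (fixed h)"
      using dim_less_of_new_element[OF _ fixed_space sub] by blast
    then show False using f(2)[OF \<open>P h\<close>] by simp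
  qed
  then show "\<exists>y\<in>S. a * y * a = a" using s by (metis mult.assoc)
qed

end

section \<open>Local units in regular algebras\<close>

text \<open>The index set \<open>P\<close> runs through the rows of all blocks together and
  \<open>\<beta>\<close> names the block, so these pairs are the positions of the entries of a block
  diagonal matrix.\<close>

definition same_block :: "'p set \<Rightarrow> ('p \<Rightarrow> 'i) \<Rightarrow> ('p \<times> 'p) set" where
  "same_block P \<beta> = {(p, p'). p \<in> P \<and> p' \<in> P \<and> \<beta> p = \<beta> p'}"

text \<open>For a subalgebra \<open>J\<close>, the largest subring having \<open>J\<close> as an
  ideal. It stands in for the original algebra and also contains \<open>1\<close>, so complements of
  idempotents stay in it.\<close>

definition idealizer :: "'r::ring_1 set \<Rightarrow> 'r set" where
  "idealizer J = {t. \<forall>j\<in>J. t * j \<in> J \<and> j * t \<in> J}"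

text \<open>Taking \<open>J = {0}\<close> gives genuine matrix units, possibly zero. Products across
  different blocks fall under the case \<open>p' \<noteq> s\<close>.\<close>

definition matrix_units_mod :: "'r::ring_1 set \<Rightarrow> 'p set \<Rightarrow> ('p \<Rightarrow> 'i) \<Rightarrow> ('p \<Rightarrow> 'p \<Rightarrow> 'r) \<Rightarrow> bool" where
  "matrix_units_mod J P \<beta> x \<longleftrightarrow>
     (\<forall>p\<in>P. \<forall>p'\<in>P. \<forall>s\<in>P. \<forall>t\<in>P. \<beta> p = \<beta> p' \<longrightarrow> \<beta> s = \<beta> t \<longrightarrow>
        x p p' * x s t - (if p' = s then x p t else 0) \<in> J)"

context kalgebra
begin

section \<open>Closure properties of the idealizer\<close>

lemma idealizer_0: "subalg J \<Longrightarrow> 0 \<in> idealizer J"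
  and idealizer_1: "1 \<in> idealizer J"
  and idealizer_add: "subalg J \<Longrightarrow> x \<in> idealizer J \<Longrightarrow> y \<in> idealizer J \<Longrightarrow> x + y \<in> idealizer J"
  and idealizer_diff: "subalg J \<Longrightarrow> x \<in> idealizer J \<Longrightarrow> y \<in> idealizer J \<Longrightarrow> x - y \<in> idealizer J"
  and idealizer_incl: "subalg J \<Longrightarrow> x \<in> J \<Longrightarrow> x \<in> idealizer J"
  by (auto simp: idealizer_def subalg_closed distrib_left distrib_right left_diff_distrib right_diff_distrib)

lemma idealizer_mult: "x \<in> idealizer J \<Longrightarrow> y \<in> idealizer J \<Longrightarrow> x * y \<in> idealizer J"
  unfolding idealizer_def by (simp add: mult.assoc) (simp add: mult.assoc[symmetric])

lemma idealizer_sum: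
  "subalg J \<Longrightarrow> (\<And>i. i \<in> I \<Longrightarrow> f i \<in> idealizer J) \<Longrightarrow> sum f I \<in> idealizer J"
  by (induction I rule: infinite_finite_induct) (auto simp: idealizer_0 idealizer_add)

lemmas idealizer_closed = idealizer_1 idealizer_add idealizer_diff idealizer_mult

lemma idealizer_left: "x \<in> idealizer J \<Longrightarrow> j \<in> J \<Longrightarrow> x * j \<in> J"
  and idealizer_right: "x \<in> idealizer J \<Longrightarrow> j \<in> J \<Longrightarrow> j * x \<in> J"
  by (auto simp: idealizer_def)

text \<open>Finitely generated right ideals of a regular ring have idempotent generators. A new
  element contributes only \<open>d' = d - e * d\<close>; the idempotent \<open>g = d' * y\<close>
  satisfies \<open>e * g = 0\<close>, and \<open>e + g - g * e\<close> fixes from the left whatever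
  \<open>e\<close> or \<open>g\<close> fixes.\<close>

lemma left_local_unit:
  assumes N: "subalg N" "vn_regular N" and D: "finite D" "D \<subseteq> N"
  shows "\<exists>e\<in>N. e * e = e \<and> (\<forall>d\<in>D. e * d = d)"
  using D
proof (induction D rule: finite_induct)
  case empty
  then show ?case using N subalg_0 by force
next
  case (insert d D)
  then obtain e where e: "e \<in> N" "e * e = e" "\<forall>d\<in>D. e * d = d" by auto
  define d' where "d' = d - e * d"
  have d'N: "d' \<in> N" using insert N e by (auto simp: d'_def intro: subalg_closed)
  then obtain y where y: "y \<in> N" "d' * y * d' = d'" using N by (auto simp: vn_regular_def)
  define g where "g = d' * y"
  have gN: "g \<in> N" using d'N y N subalg_mult by (auto simp: g_def)
  have "e * d' = 0" using e(2) by (simp add: d'_def algebra_simps mult.assoc[symmetric])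
  then have eg: "e * g = 0" by (simp add: g_def mult.assoc[symmetric])
  have gg: "g * g = g" "g * d' = d'" using y(2) by (simp_all add: g_def mult.assoc[symmetric])
  define h where "h = e + g - g * e"
  have he: "h * e = e" by (simp add: h_def algebra_simps e(2) mult.assoc)
  have hg: "h * g = g" by (simp add: h_def algebra_simps eg gg mult.assoc)
  have hh: "h * h = h"
  proof -
    have "h * h = h * e + h * g - h * g * e"
      by (subst (2) h_def) (simp add: algebra_simps)
    then show ?thesis using he hg by (simp add: h_def)
  qed
  have "h * d = d"
  proof -
    have "h * d' = d'" using hg gg by (metis mult.assoc)
    moreover have "h * (e * d) = e * d" using he by (metis mult.assoc)
    ultimately show ?thesis unfolding d'_def by (simp add: algebra_simps)
  qed
  moreover have "h * c = c" if "c \<in> D" for c using he e(3) that by (metis mult.assoc)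
  moreover have "h \<in> N" using N e gN by (auto simp: h_def intro: subalg_closed)
  ultimately show ?case using hh by blast
qed

lemma right_local_unit:
  assumes N: "subalg N" "vn_regular N" and D: "finite D" "D \<subseteq> N"
  shows "\<exists>e\<in>N. e * e = e \<and> (\<forall>d\<in>D. d * e = d)"
  using D
proof (induction D rule: finite_induct)
  case empty
  then show ?case using N subalg_0 by force
next
  case (insert d D)
  then obtain e where e: "e \<in> N" "e * e = e" "\<forall>d\<in>D. d * e = d" by auto
  define d' where "d' = d - d * e"
  have d'N: "d' \<in> N" using insert N e by (auto simp: d'_def intro: subalg_closed)
  then obtain y where y: "y \<in> N" "d' * y * d' = d'" using N by (auto simp: vn_regular_def)
  define g where "g = y * d'"
  have gN: "g \<in> N" using d'N y N subalg_mult by (auto simp: g_def)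
  have "d' * e = 0" using e(2) by (simp add: d'_def algebra_simps)
  then have ge: "g * e = 0" by (simp add: g_def mult.assoc)
  have gg: "g * g = g" "d' * g = d'" using y(2) by (simp_all add: g_def mult.assoc)
  define h where "h = e + g - e * g"
  have eh: "e * h = e" by (simp add: h_def algebra_simps e(2) mult.assoc[symmetric])
  have gh: "g * h = g" by (simp add: h_def algebra_simps ge gg mult.assoc[symmetric])
  have hh: "h * h = h"
  proof -
    have "h * h = e * h + g * h - e * (g * h)"
      by (subst (1) h_def) (simp add: algebra_simps)
    then show ?thesis using eh gh by (simp add: h_def)
  qed
  have "d * h = d"
  proof -
    have "d' * h = d'" using gh gg by (metis mult.assoc)
    moreover have "d * e * h = d * e" using eh by (metis mult.assoc)
    ultimately show ?thesis unfolding d'_def by (simp add: algebra_simps)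
  qed
  moreover have "c * h = c" if "c \<in> D" for c using eh e(3) that by (metis mult.assoc)
  moreover have "h \<in> N" using N e gN by (auto simp: h_def intro: subalg_closed)
  ultimately show ?case using hh by blast
qed

text \<open>One-sided units are combined by \<open>1 - u = (1 - f) * (1 - e)\<close>. Letting
  \<open>f\<close> also fix \<open>e\<close> gives \<open>e * f = e\<close>, which makes
  \<open>u\<close> idempotent.\<close>

lemma local_unit:
  assumes N: "subalg N" "vn_regular N" and D: "finite D" "D \<subseteq> N"
  shows "\<exists>u\<in>N. u * u = u \<and> (\<forall>d\<in>D. u * d = d \<and> d * u = d)"
proof -
  obtain e where e: "e \<in> N" "e * e = e" "\<forall>d\<in>D. e * d = d"
    using left_local_unit[OF N D] by blast
  obtain f where f: "f \<in> N" "f * f = f" "\<forall>d\<in>insert e D. d * f = d"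
    using right_local_unit[OF N, of "insert e D"] D e by auto
  define u where "u = e + f - f * e"
  have eu: "e * u = e" using f(3) by (simp add: u_def algebra_simps e(2) mult.assoc[symmetric])
  have fu: "f * u = f" by (simp add: u_def algebra_simps f(2) mult.assoc[symmetric])
  have "u * u = e * u + f * u - f * (e * u)"
    by (subst (1) u_def) (simp add: algebra_simps)
  then have "u * u = u" using eu fu by (simp add: u_def)
  moreover have "u * d = d" if "d \<in> D" for d
    using e(3) that by (simp add: u_def algebra_simps mult.assoc)
  moreover have "d * u = d" if "d \<in> D" for d
    using f(3) that by (simp add: u_def algebra_simps mult.assoc[symmetric])
  moreover have "u \<in> N" using N e f by (auto simp: u_def intro: subalg_closed)
  ultimately show ?thesis by blast
qed

lemma corner_subalg: "subalg J \<Longrightarrow> subalg {j \<in> J. q * j = j \<and> j * q = j}"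
  unfolding subalg_def subspace_def
  by (auto simp: scale_mult_left scale_mult_right distrib_left distrib_right)
    (metis mult.assoc)+

text \<open>The idempotent \<open>q\<close> is taken from the idealizer, so it may be
  \<open>1\<close> or a lifted unit; \<open>q * y * q\<close> is still in \<open>J\<close> and
  replaces the quasi-inverse \<open>y\<close>.\<close>

lemma corner_vn_regular:
  assumes "vn_regular J" "q \<in> idealizer J" "q * q = q"
  shows "vn_regular {j \<in> J. q * j = j \<and> j * q = j}"
  unfolding vn_regular_def
proof clarify
  fix a assume a: "a \<in> J" "q * a = a" "a * q = a"
  then obtain y where y: "y \<in> J" "a * y * a = a" using assms by (auto simp: vn_regular_def)
  have "a * (q * y * q) * a = a"
  proof -
    have "a * (q * y * q) * a = (a * q) * y * (q * a)" by (simp add: mult.assoc)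
    then show ?thesis using a y by simp
  qed
  moreover have "q * y * q \<in> J" using y assms by (simp add: idealizer_left idealizer_right)
  moreover have "q * (q * y * q) = q * y * q" "(q * y * q) * q = q * y * q"
    using assms(3) by (simp_all add: mult.assoc) (simp add: mult.assoc[symmetric])
  ultimately show "\<exists>y\<in>{j \<in> J. q * j = j \<and> j * q = j}. a * y * a = a" by blast
qed

text \<open>The elements of \<open>L\<close> and \<open>M\<close> are fixed by \<open>q\<close> on
  one side only, so they are replaced by \<open>l * y l * q\<close> and \<open>q * (y m * m)\<close>
  in the corner. A left unit of the first fixes \<open>l\<close>, since
  \<open>l * y l * q * l = l\<close>; dually for \<open>m\<close>.\<close>

lemma corner_local_unit:
  assumes J: "subalg J" "vn_regular J" and q: "q \<in> idealizer J" "q * q = q"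
    and L: "finite L" "L \<subseteq> J" "\<forall>l\<in>L. q * l = l"
    and M: "finite M" "M \<subseteq> J" "\<forall>m\<in>M. m * q = m"
  shows "\<exists>h\<in>J. h * h = h \<and> q * h = h \<and> h * q = h \<and> (\<forall>l\<in>L. h * l = l) \<and> (\<forall>m\<in>M. m * h = m)"
proof -
  let ?N = "{j \<in> J. q * j = j \<and> j * q = j}"
  obtain y where y: "\<forall>a\<in>J. y a \<in> J \<and> a * y a * a = a"
    using J(2) unfolding vn_regular_def by metis
  define D where "D = (\<lambda>l. l * y l * q) ` L \<union> (\<lambda>m. q * (y m * m)) ` M"
  have "l * y l * q \<in> ?N" if "l \<in> L" for l
  proof -
    have "l * y l * q \<in> J" using that L(2) y J(1) q(1) by (meson idealizer_right subalg_mult subsetD)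
    moreover have "q * (l * y l * q) = l * y l * q" using that L by (metis mult.assoc)
    moreover have "l * y l * q * q = l * y l * q" using q(2) by (simp add: mult.assoc)
    ultimately show ?thesis by simp
  qed
  moreover have "q * (y m * m) \<in> ?N" if "m \<in> M" for m
  proof -
    have "q * (y m * m) \<in> J" using that M(2) y J(1) q(1) by (meson idealizer_left subalg_mult subsetD)
    moreover have "q * (y m * m) * q = q * (y m * m)" using that M by (metis mult.assoc)
    moreover have "q * (q * (y m * m)) = q * (y m * m)" using q(2) by (metis mult.assoc)
    ultimately show ?thesis by simp
  qed
  ultimately have "D \<subseteq> ?N" unfolding D_def by blast
  moreover have "finite D" using L M by (simp add: D_def)
  ultimately obtain h where h: "h \<in> ?N" "h * h = h" "\<forall>d\<in>D. h * d = d \<and> d * h = d"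
    using local_unit[OF corner_subalg[OF J(1)] corner_vn_regular[OF J(2) q]] by meson
  have "h * l = l" if "l \<in> L" for l
  proof -
    have "l * y l * q * l = l" using that L y by (metis mult.assoc subsetD)
    moreover have "h * (l * y l * q) = l * y l * q" using h that by (auto simp: D_def)
    ultimately show ?thesis by (metis mult.assoc)
  qed
  moreover have "m * h = m" if "m \<in> M" for m
  proof -
    have "m * (q * (y m * m)) = m" using that M y by (metis mult.assoc subsetD)
    moreover have "q * (y m * m) * h = q * (y m * m)" using h that by (auto simp: D_def)
    ultimately show ?thesis by (metis mult.assoc)
  qed
  ultimately show ?thesis using h by blast
qed

text \<open>The defect \<open>d = x - x * y * x\<close> lies in the regular ideal and has a
  quasi-inverse \<open>z\<close> there. Since \<open>x * (1 - y * x) = d = (1 - x * y) * x\<close>,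
  the correction \<open>?w\<close> contributes \<open>d * z * d = d\<close>, exactly what
  \<open>x * y * x\<close> lacks.\<close>

lemma quasi_inverse_lift:
  assumes J: "subalg J" "vn_regular J" and xy: "x \<in> idealizer J" "y \<in> idealizer J" "x - x * y * x \<in> J"
  shows "\<exists>x'. x' - y \<in> J \<and> x * x' * x = x"
proof -
  define d where "d = x - x * y * x"
  obtain z where z: "z \<in> J" "d * z * d = d" using J xy by (auto simp: vn_regular_def d_def)
  let ?w = "(1 - y * x) * z * (1 - x * y)"
  have "?w \<in> J"
    by (rule idealizer_right[OF _ idealizer_left[OF _ z(1)]]) (use J xy in \<open>auto intro!: idealizer_closed\<close>)
  moreover have "x * (y + ?w) * x = x * y * x + (x * (1 - y * x)) * z * ((1 - x * y) * x)"
    by (simp add: distrib_left distrib_right mult.assoc)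
  moreover have "x * (1 - y * x) = d" "(1 - x * y) * x = d"
    by (simp_all add: d_def algebra_simps)
  ultimately show ?thesis using z(2) by (intro exI[of _ "y + ?w"]) (simp add: d_def)
qed

end

section \<open>Lifting matrix units\<close>

context kalgebra
begin

section \<open>Congruences modulo an ideal of its idealizer\<close>

lemma congruent_mult:
  assumes "subalg J" "u - u' \<in> J" "v - v' \<in> J" "u' \<in> idealizer J" "v \<in> idealizer J"
  shows "u * v - u' * v' \<in> J"
proof -
  have "u * v - u' * v' = (u - u') * v + u' * (v - v')" by (simp add: algebra_simps)
  then show ?thesis using assms by (simp add: idealizer_left idealizer_right subalg_add)
qed

lemma congruent_trans: "subalg J \<Longrightarrow> u - v \<in> J \<Longrightarrow> v - w \<in> J \<Longrightarrow> u - w \<in> J"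
  using subalg_add[of J "u - v" "v - w"] by simp

lemma congruent_sym: "subalg J \<Longrightarrow> u - v \<in> J \<Longrightarrow> v - u \<in> J"
  using subalg_neg[of J "u - v"] by simp

lemma congruent_idealizer: "subalg J \<Longrightarrow> u - v \<in> J \<Longrightarrow> v \<in> idealizer J \<Longrightarrow> u \<in> idealizer J"
  using idealizer_add[of J "u - v" v] idealizer_incl[of J "u - v"] by simp

text \<open>The products \<open>a s * b s\<close> are orthogonal idempotents, the diagonal matrix
  units. New indices are lifted inside the complement of their sum.\<close>

lemma orthogonal_system_sum:
  fixes a b :: "'p \<Rightarrow> 'r"
  assumes Q: "finite Q"
    and ba: "\<And>p p'. p \<in> Q \<Longrightarrow> p' \<in> Q \<Longrightarrow> b p * a p' = (if p = p' then q (\<beta> p) else 0)"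
    and abq: "\<And>p. p \<in> Q \<Longrightarrow> a p * q (\<beta> p) = a p" "\<And>p. p \<in> Q \<Longrightarrow> q (\<beta> p) * b p = b p"
  shows "(\<forall>s\<in>Q. (\<Sum>s\<in>Q. a s * b s) * a s = a s \<and> b s * (\<Sum>s\<in>Q. a s * b s) = b s)
    \<and> (\<Sum>s\<in>Q. a s * b s) * (\<Sum>s\<in>Q. a s * b s) = (\<Sum>s\<in>Q. a s * b s)"
proof -
  define u where "u = (\<Sum>s\<in>Q. a s * b s)"
  have ua: "u * a s = a s" if "s \<in> Q" for s
  proof -
    have "u * a s = (\<Sum>r\<in>Q. a r * (b r * a s))" by (simp add: u_def sum_distrib_right mult.assoc)
    also have "\<dots> = (\<Sum>r\<in>Q. if r = s then a s else 0)"
      using that by (intro sum.cong) (auto simp: ba abq)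
    finally show ?thesis using that Q by simp
  qed
  moreover have "b s * u = b s" if "s \<in> Q" for s
  proof -
    have "b s * u = (\<Sum>r\<in>Q. (b s * a r) * b r)" by (simp add: u_def sum_distrib_left mult.assoc)
    also have "\<dots> = (\<Sum>r\<in>Q. if r = s then b s else 0)"
      using that by (intro sum.cong) (auto simp: ba abq)
    finally show ?thesis using that Q by simp
  qed
  moreover have "u * u = u"
  proof -
    have "u * u = (\<Sum>s\<in>Q. u * a s * b s)" by (subst (2) u_def) (simp add: sum_distrib_left mult.assoc)
    then show ?thesis using ua by (simp add: u_def)
  qed
  ultimately show ?thesis unfolding u_def by blast
qed

text \<open>The unit at \<open>(p, p')\<close> is lifted to \<open>a p * b p'\<close>. Each new index replaces the idempotent \<open>q\<close> of its
block by a smaller one; starting with \<open>q = 1\<close> makes a separate lifting of idempotents unnecessary.\<close>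

lemma matrix_units_partial_lift:
  fixes x :: "'p \<Rightarrow> 'p \<Rightarrow> 'r" and \<beta> :: "'p \<Rightarrow> 'i"
  assumes J: "subalg J" "vn_regular J" and x: "matrix_units_mod J P \<beta> x"
    and x_idealizer: "\<forall>p\<in>P. \<forall>p'\<in>P. \<beta> p = \<beta> p' \<longrightarrow> x p p' \<in> idealizer J"
    and base: "\<forall>p\<in>P. ob (\<beta> p) \<in> P \<and> \<beta> (ob (\<beta> p)) = \<beta> p"
    and Q: "finite Q" "Q \<subseteq> P"
  shows "\<exists>a b q. (\<forall>p\<in>Q. a p - x p (ob (\<beta> p)) \<in> J \<and> b p - x (ob (\<beta> p)) p \<in> J)
      \<and> (\<forall>i. q i * q i = q i \<and> q i \<in> idealizer J)
      \<and> (\<forall>p\<in>P. let y = x (ob (\<beta> p)) (ob (\<beta> p)) in q (\<beta> p) * y - y \<in> J \<and> y * q (\<beta> p) - y \<in> J)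
      \<and> (\<forall>p\<in>Q. a p * q (\<beta> p) = a p \<and> q (\<beta> p) * b p = b p)
      \<and> (\<forall>p\<in>Q. \<forall>p'\<in>Q. b p * a p' = (if p = p' then q (\<beta> p) else 0))"
  using Q
proof (induction Q rule: finite_induct)
  case empty
  show ?case
    by (rule exI[of _ "\<lambda>_. 0"], rule exI[of _ "\<lambda>_. 0"], rule exI[of _ "\<lambda>_. 1"])
      (use J in \<open>auto simp: idealizer_1 subalg_0\<close>)
next
  case (insert p Q)
  have xU: "x p p' \<in> idealizer J" if "p \<in> P" "p' \<in> P" "\<beta> p = \<beta> p'" for p p'
    using x_idealizer that by blast
  have o: "ob (\<beta> p) \<in> P \<and> \<beta> (ob (\<beta> p)) = \<beta> p" if "p \<in> P" for p
    using base that by blast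
  \<comment> \<open>Every unit of a block factors modulo \<open>J\<close> through the base index
    \<open>ob (\<beta> p)\<close>: for \<open>p\<close> and \<open>p'\<close> in one block,
    \<open>y p * z p'\<close> is congruent to \<open>x p p'\<close>, and \<open>w p\<close> is the
    diagonal unit at the base.\<close>
  define y where "y p = x p (ob (\<beta> p))" for p
  define z where "z p = x (ob (\<beta> p)) p" for p
  define w where "w p = x (ob (\<beta> p)) (ob (\<beta> p))" for p
  have "Q \<subseteq> P" using insert.prems by simp
  from insert.IH[OF this, unfolded Let_def, folded y_def z_def w_def] obtain a b q where IH: "\<forall>p\<in>Q. a p - y p \<in> J \<and> b p - z p \<in> J"
      "\<forall>i. q i * q i = q i \<and> q i \<in> idealizer J"
      "\<forall>p\<in>P. q (\<beta> p) * w p - w p \<in> J \<and> w p * q (\<beta> p) - w p \<in> J"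
      "\<forall>p\<in>Q. a p * q (\<beta> p) = a p \<and> q (\<beta> p) * b p = b p"
      "\<forall>p\<in>Q. \<forall>p'\<in>Q. b p * a p' = (if p = p' then q (\<beta> p) else 0)"
    by (elim exE conjE) (rule that)
  have ab: "\<And>p. p \<in> Q \<Longrightarrow> a p - y p \<in> J" "\<And>p. p \<in> Q \<Longrightarrow> b p - z p \<in> J"
    and q: "\<And>i. q i * q i = q i" "\<And>i. q i \<in> idealizer J"
    and qw: "\<And>p. p \<in> P \<Longrightarrow> q (\<beta> p) * w p - w p \<in> J" "\<And>p. p \<in> P \<Longrightarrow> w p * q (\<beta> p) - w p \<in> J"
    and abq: "\<And>p. p \<in> Q \<Longrightarrow> a p * q (\<beta> p) = a p" "\<And>p. p \<in> Q \<Longrightarrow> q (\<beta> p) * b p = b p"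
    and ba: "\<And>p p'. p \<in> Q \<Longrightarrow> p' \<in> Q \<Longrightarrow> b p * a p' = (if p = p' then q (\<beta> p) else 0)"
    using IH by blast+
  have pP: "p \<in> P" and QP: "Q \<subseteq> P" using insert.prems by auto
  have yU: "y p \<in> idealizer J" and zU: "z p \<in> idealizer J" and wU: "w p \<in> idealizer J" if "p \<in> P" for p
    using xU o[OF that] that by (simp_all add: y_def z_def w_def)
  have aU: "a p \<in> idealizer J" and bU: "b p \<in> idealizer J" if "p \<in> Q" for p
    using congruent_idealizer[OF J(1)] ab that yU zU QP by blast+
  have xx: "x p p' * x s t - (if p' = s then x p t else 0) \<in> J"
    if "p \<in> P" "p' \<in> P" "s \<in> P" "t \<in> P" "\<beta> p = \<beta> p'" "\<beta> s = \<beta> t" for p p' s t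
    using x that unfolding matrix_units_mod_def by blast
  have zy: "z s * y t - (if s = t then w s else 0) \<in> J" if "s \<in> P" "t \<in> P" for s t
    using xx[of "ob (\<beta> s)" s t "ob (\<beta> t)"] that o[of s] o[of t]
    by (auto simp: y_def z_def w_def split: if_splits)
  have yz: "y s * z s - x s s \<in> J" and yw: "y s * w s - y s \<in> J" and wz: "w s * z s - z s \<in> J"
    and xy: "x s s * y s - y s \<in> J" and ww: "w s * w s - w s \<in> J"
    if "s \<in> P" for s
    using xx[of s "ob (\<beta> s)" "ob (\<beta> s)" s] xx[of s "ob (\<beta> s)" "ob (\<beta> s)" "ob (\<beta> s)"]
      xx[of "ob (\<beta> s)" "ob (\<beta> s)" "ob (\<beta> s)" s] xx[of s s s "ob (\<beta> s)"]
      xx[of "ob (\<beta> s)" "ob (\<beta> s)" "ob (\<beta> s)" "ob (\<beta> s)"] that o[of s]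
    by (auto simp: y_def z_def w_def)
  note tr = congruent_trans[OF J(1)] and sy = congruent_sym[OF J(1)]
    and mu = congruent_mult[OF J(1)] and re = subalg_0[OF J(1)]
  define i where "i = \<beta> p"
  define u where "u = (\<Sum>s\<in>Q. a s * b s)"
  have uU: "u \<in> idealizer J" unfolding u_def using J aU bU by (intro idealizer_sum idealizer_mult)
  note u_facts = orthogonal_system_sum[of Q b a q \<beta>, OF insert.hyps(1) ba abq, folded u_def]
  have ua: "u * a s = a s" and bu: "b s * u = b s" if "s \<in> Q" for s
    using u_facts that by blast+
  have uu: "u * u = u" using u_facts by blast
  have J_sum: "sum f Q \<in> J" if "\<And>s. s \<in> Q \<Longrightarrow> f s \<in> J" for f
    using that J(1) subspace_sum[of J Q f] unfolding subalg_def by blast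
  \<comment> \<open>The new index differs from all earlier ones, so \<open>y p\<close> and
    \<open>z p\<close> are already orthogonal to \<open>u\<close> modulo \<open>J\<close>; cutting
    them by \<open>1 - u\<close> therefore does not change their classes.\<close>
  have uy: "u * y p \<in> J"
  proof -
    have "a s * (b s * y p) \<in> J" if "s \<in> Q" for s
    proof -
      have "b s * y p - z s * y p \<in> J"
        using mu[OF ab(2)[OF that], of "y p" "y p"] re zU yU pP QP that by auto
      moreover have "z s * y p \<in> J" using zy[of s p] that insert.hyps QP pP by (auto split: if_splits)
      ultimately have "b s * y p \<in> J" using subalg_add[OF J(1)] by fastforce
      then show ?thesis using aU that idealizer_left by blast
    qed
    then show ?thesis unfolding u_def sum_distrib_right mult.assoc by (rule J_sum)
  qed
  have zu: "z p * u \<in> J"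
  proof -
    have "z p * a s * b s \<in> J" if "s \<in> Q" for s
    proof -
      have "z p * a s - z p * y s \<in> J"
        using mu[of "z p" "z p", OF _ ab(1)[OF that]] re zU aU pP QP that by auto
      moreover have "z p * y s \<in> J" using zy[of p s] that insert.hyps QP pP by (auto split: if_splits)
      ultimately have "z p * a s \<in> J" using subalg_add[OF J(1)] by fastforce
      then show ?thesis using bU that idealizer_right by blast
    qed
    then show ?thesis unfolding u_def sum_distrib_left mult.assoc[symmetric] by (rule J_sum)
  qed
  \<comment> \<open>Cutting with \<open>1 - u\<close> makes the new unit exactly orthogonal to the
    earlier ones, and cutting with \<open>q i\<close> places its idempotent below the one already in
    use for the block.\<close>
  define \<alpha> where "\<alpha> = (1 - u) * y p * q i"
  define \<gamma>0 where "\<gamma>0 = q i * z p * (1 - u)"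
  have vU: "1 - u \<in> idealizer J" using J uU by (simp add: idealizer_closed)
  have vv: "(1 - u) * (1 - u) = 1 - u" using uu by (simp add: algebra_simps)
  note mem = yU[OF pP] zU[OF pP] wU[OF pP] q(2) vU
  have vy: "(1 - u) * y p - y p \<in> J" using uy subalg_neg[OF J(1)] by (simp add: algebra_simps)
  have zv: "z p * (1 - u) - z p \<in> J" using zu subalg_neg[OF J(1)] by (simp add: algebra_simps)
  have yq: "y p * q i - y p \<in> J"
  proof -
    have "y p * q i - y p * w p * q i \<in> J"
      using mu[OF sy[OF yw[OF pP]], of "q i" "q i"] re mem by (simp add: idealizer_mult)
    moreover have "y p * w p * q i - y p * w p \<in> J"
      using mu[of "y p" "y p" "w p * q i" "w p"] re mem qw(2)[OF pP]
      by (simp add: idealizer_mult i_def mult.assoc)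
    ultimately show ?thesis using yw[OF pP] tr by blast
  qed
  have qz: "q i * z p - z p \<in> J"
  proof -
    have "q i * z p - q i * (w p * z p) \<in> J"
      using mu[of "q i" "q i", OF _ sy[OF wz[OF pP]]] re mem by simp
    moreover have "q i * (w p * z p) - w p * z p \<in> J"
      using mu[of "q i * w p" "w p" "z p" "z p"] re mem qw(1)[OF pP]
      by (simp add: idealizer_mult i_def mult.assoc)
    ultimately show ?thesis using wz[OF pP] tr by blast
  qed
  have \<alpha>y: "\<alpha> - y p \<in> J"
    using tr[OF _ yq] mu[OF vy, of "q i" "q i"] re mem by (simp add: \<alpha>_def)
  have \<gamma>0z: "\<gamma>0 - z p \<in> J"
    using tr[OF _ zv] mu[OF qz, of "1 - u" "1 - u"] re mem by (simp add: \<gamma>0_def)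
  have \<alpha>U: "\<alpha> \<in> idealizer J" and \<gamma>0U: "\<gamma>0 \<in> idealizer J"
    unfolding \<alpha>_def \<gamma>0_def using mem by (simp_all add: idealizer_mult)
  have "\<alpha> * \<gamma>0 * \<alpha> - \<alpha> \<in> J"
  proof -
    have "\<alpha> * \<gamma>0 * \<alpha> - y p * z p * y p \<in> J"
      by (intro mu \<alpha>y \<gamma>0z idealizer_mult mem \<alpha>U \<gamma>0U)
    moreover have "y p * z p * y p - x p p * y p \<in> J"
      using mu[OF yz[OF pP], of "y p" "y p"] re mem xU[OF pP pP] by simp
    ultimately show ?thesis using xy[OF pP] sy[OF \<alpha>y] tr by blast
  qed
  then obtain \<gamma>1 where \<gamma>1: "\<gamma>1 - \<gamma>0 \<in> J" "\<alpha> * \<gamma>1 * \<alpha> = \<alpha>"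
    using quasi_inverse_lift[OF J \<alpha>U \<gamma>0U] sy by blast
  \<comment> \<open>Cutting the quasi-inverse costs nothing: \<open>\<alpha>\<close> absorbs
    \<open>q i\<close> on the right and \<open>1 - u\<close> on the left, so
    \<open>\<alpha> * \<gamma> * \<alpha> = \<alpha>\<close> survives.\<close>
  define \<gamma> where "\<gamma> = q i * \<gamma>1 * (1 - u)"
  have \<alpha>q: "\<alpha> * q i = \<alpha>" by (simp add: \<alpha>_def mult.assoc q(1))
  have v\<alpha>: "(1 - u) * \<alpha> = \<alpha>" using vv by (metis \<alpha>_def mult.assoc)
  have q\<gamma>: "q i * \<gamma> = \<gamma>" using q(1) by (metis \<gamma>_def mult.assoc)
  have \<gamma>v: "\<gamma> * (1 - u) = \<gamma>" by (simp add: \<gamma>_def mult.assoc vv)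
  have \<alpha>\<gamma>\<alpha>: "\<alpha> * \<gamma> * \<alpha> = \<alpha>"
  proof -
    have "\<alpha> * \<gamma> * \<alpha> = (\<alpha> * q i) * \<gamma>1 * ((1 - u) * \<alpha>)" by (simp add: \<gamma>_def mult.assoc)
    then show ?thesis using \<gamma>1 \<alpha>q v\<alpha> by simp
  qed
  have \<gamma>1U: "\<gamma>1 \<in> idealizer J" using congruent_idealizer[OF J(1) \<gamma>1(1) \<gamma>0U] .
  have \<gamma>U: "\<gamma> \<in> idealizer J" unfolding \<gamma>_def using mem \<gamma>1U by (simp add: idealizer_mult)
  have \<gamma>z: "\<gamma> - z p \<in> J"
  proof -
    have "\<gamma> - q i * z p * (1 - u) \<in> J"
      unfolding \<gamma>_def using tr[OF \<gamma>1(1) \<gamma>0z] re mem \<gamma>1U by (intro mu) (simp_all add: idealizer_mult)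
    then show ?thesis using \<gamma>0z tr unfolding \<gamma>0_def by blast
  qed
  \<comment> \<open>An idempotent below \<open>q i\<close> and congruent to \<open>w p\<close>; it
    becomes the new idempotent of block \<open>i\<close>.\<close>
  define q' where "q' = \<gamma> * \<alpha>"
  have q'q': "q' * q' = q'" unfolding q'_def using \<alpha>\<gamma>\<alpha> by (metis mult.assoc)
  have qq': "q i * q' = q'" "q' * q i = q'" unfolding q'_def using q\<gamma> \<alpha>q by (metis mult.assoc)+
  have q'U: "q' \<in> idealizer J" unfolding q'_def using \<gamma>U \<alpha>U by (rule idealizer_mult)
  have q'w: "q' - w p \<in> J"
    using tr[OF mu[OF \<gamma>z \<alpha>y zU[OF pP] \<alpha>U]] zy[of p p] pP by (simp add: q'_def)
  define qn where "qn = q(i := q')"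
  \<comment> \<open>Earlier entries are cut down to the new idempotent, which changes nothing
    outside block \<open>i\<close>. The extra factor in \<open>q' * \<gamma>\<close> ensures
    \<open>q' * bn p = bn p\<close>.\<close>
  define an where "an s = (if s = p then \<alpha> else a s * qn (\<beta> s))" for s
  define bn where "bn s = (if s = p then q' * \<gamma> else qn (\<beta> s) * b s)" for s
  have qn_idem: "qn j * qn j = qn j" "qn j \<in> idealizer J" for j
    using q q'q' q'U by (auto simp: qn_def)
  have qnq: "qn j * q j = qn j" "q j * qn j = qn j" for j
    using q qq' by (auto simp: qn_def)
  have w_eq: "w s = w p" if "\<beta> s = i" for s using that by (simp add: w_def i_def)
  have qn_w: "qn (\<beta> s) * w s - w s \<in> J" "w s * qn (\<beta> s) - w s \<in> J" if "s \<in> P" for s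
  proof -
    have "q' * w p - w p * w p \<in> J" "w p * q' - w p * w p \<in> J"
      using mu[OF q'w, of "w p" "w p"] mu[of "w p" "w p", OF _ q'w] re mem q'U by simp_all
    then have "q' * w p - w p \<in> J" "w p * q' - w p \<in> J" using tr ww[OF pP] by blast+
    then show "qn (\<beta> s) * w s - w s \<in> J" "w s * qn (\<beta> s) - w s \<in> J"
      using qw[OF that] w_eq[of s] by (auto simp: qn_def)
  qed
  have an_y: "an s - y s \<in> J" and bn_z: "bn s - z s \<in> J" if mem_s: "s \<in> insert p Q" for s
  proof -
    consider "s = p" | "s \<noteq> p" "s \<in> Q" "\<beta> s = i" | "s \<noteq> p" "s \<in> Q" "\<beta> s \<noteq> i"
      using mem_s by blast
    then have "an s - y s \<in> J \<and> bn s - z s \<in> J"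
    proof cases
      case 1
      have "q' * \<gamma> - w p * z p \<in> J" by (intro mu q'w \<gamma>z mem \<gamma>U)
      then show ?thesis using 1 \<alpha>y tr wz[OF pP] by (auto simp: an_def bn_def)
    next
      case 2
      have sP: "s \<in> P" using 2 QP by blast
      have "a s * q' - y s * w s \<in> J"
        using mu[OF ab(1)[OF 2(2)], of q' "w s"] q'w w_eq[OF 2(3)] yU[OF sP] q'U by simp
      moreover have "q' * b s - w s * z s \<in> J"
        using mu[OF _ ab(2)[OF 2(2)], of q' "w s"] q'w w_eq[OF 2(3)] wU[OF sP] bU[OF 2(2)] by simp
      ultimately show ?thesis using 2 tr yw[OF sP] wz[OF sP] by (auto simp: an_def bn_def qn_def)
    next
      case 3
      then show ?thesis using ab abq by (auto simp: an_def bn_def qn_def)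
    qed
    then show "an s - y s \<in> J" "bn s - z s \<in> J" by auto
  qed
  have \<alpha>q': "\<alpha> * q' = \<alpha>" using \<alpha>\<gamma>\<alpha> by (simp add: q'_def mult.assoc)
  have an_qn: "an s * qn (\<beta> s) = an s" "qn (\<beta> s) * bn s = bn s" for s
    using \<alpha>q' q'q' qn_idem(1)[of "\<beta> s"]
    by (auto simp: an_def bn_def qn_def i_def mult.assoc) (auto simp: mult.assoc[symmetric])
  have \<gamma>a: "\<gamma> * a s = 0" if "s \<in> Q" for s
  proof -
    have "\<gamma> * a s = \<gamma> * ((1 - u) * a s)" using \<gamma>v by (metis mult.assoc)
    then show ?thesis using ua[OF that] by (simp add: left_diff_distrib)
  qed
  have b\<alpha>: "b s * \<alpha> = 0" if "s \<in> Q" for s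
  proof -
    have "b s * \<alpha> = (b s * (1 - u)) * \<alpha>" using v\<alpha> by (metis mult.assoc)
    then show ?thesis using bu[OF that] by (simp add: right_diff_distrib)
  qed
  have bn_an: "bn s * an t = (if s = t then qn (\<beta> s) else 0)"
    if mem_st: "s \<in> insert p Q" "t \<in> insert p Q" for s t
  proof -
    consider "s = p" "t = p" | "s = p" "t \<noteq> p" "t \<in> Q" | "s \<noteq> p" "s \<in> Q" "t = p"
      | "s \<noteq> p" "s \<in> Q" "t \<noteq> p" "t \<in> Q" using mem_st by blast
    then show ?thesis
    proof cases
      case 1
      then show ?thesis using q'q' by (simp add: bn_def an_def qn_def i_def mult.assoc q'_def[symmetric])
    next
      case 2
      have "q' * \<gamma> * (a t * qn (\<beta> t)) = q' * (\<gamma> * a t) * qn (\<beta> t)" by (simp add: mult.assoc)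
      then show ?thesis using 2 \<gamma>a by (simp add: bn_def an_def)
    next
      case 3
      have "qn (\<beta> s) * b s * \<alpha> = qn (\<beta> s) * (b s * \<alpha>)" by (simp add: mult.assoc)
      then show ?thesis using 3 b\<alpha> by (simp add: bn_def an_def)
    next
      case 4
      have "bn s * an t = qn (\<beta> s) * (b s * a t) * qn (\<beta> t)"
        using 4 by (simp add: bn_def an_def mult.assoc)
      then show ?thesis using 4 ba qnq qn_idem(1) by simp
    qed
  qed
  show ?case
    using an_y bn_z qn_idem qn_w an_qn bn_an
    by (intro exI[of _ an] exI[of _ bn] exI[of _ qn]) (simp add: y_def z_def w_def Let_def)
qed


text \<open>Completeness makes each \<open>d\<close> recoverable from the entries
  \<open>b p * d\<close>, and likewise from the entries \<open>d * a p\<close>. One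
  \<open>h i\<close> per block is a left unit for the former and a right unit for the latter, and
  \<open>e\<close> is the matrix with \<open>h\<close> repeated along the diagonal. Repeating the
  same element within a block is what lets \<open>e\<close> commute with every
  \<open>a p * b p'\<close> of that block.\<close>

lemma complete_system_local_unit:
  fixes a b :: "'p \<Rightarrow> 'r" and q :: "'i \<Rightarrow> 'r" and \<beta> :: "'p \<Rightarrow> 'i"
  assumes J: "subalg J" "vn_regular J" and P: "finite P"
    and abU: "\<And>p. p \<in> P \<Longrightarrow> a p \<in> idealizer J" "\<And>p. p \<in> P \<Longrightarrow> b p \<in> idealizer J"
    and q: "\<And>i. q i * q i = q i" "\<And>i. q i \<in> idealizer J"
    and abq: "\<And>p. p \<in> P \<Longrightarrow> a p * q (\<beta> p) = a p" "\<And>p. p \<in> P \<Longrightarrow> q (\<beta> p) * b p = b p"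
    and ba: "\<And>p p'. p \<in> P \<Longrightarrow> p' \<in> P \<Longrightarrow> b p * a p' = (if p = p' then q (\<beta> p) else 0)"
    and complete: "(\<Sum>p\<in>P. a p * b p) = 1"
    and D: "finite D" "D \<subseteq> J"
  shows "\<exists>h e. e \<in> J \<and> e * e = e \<and> (\<forall>d\<in>D. e * d = d \<and> d * e = d)
    \<and> (\<forall>i. h i \<in> J \<and> h i * h i = h i \<and> q i * h i = h i \<and> h i * q i = h i)
    \<and> (\<forall>p\<in>P. e * a p = a p * h (\<beta> p) \<and> b p * e = h (\<beta> p) * b p)"
proof -
  have "\<exists>h\<in>J. h * h = h \<and> q i * h = h \<and> h * q i = h
      \<and> (\<forall>l\<in>(\<lambda>(p, d). b p * d) ` ({p \<in> P. \<beta> p = i} \<times> D). h * l = l)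
      \<and> (\<forall>l\<in>(\<lambda>(p, d). d * a p) ` ({p \<in> P. \<beta> p = i} \<times> D). l * h = l)" for i
  proof (rule corner_local_unit[OF J q(2) q(1)])
    show "\<forall>l\<in>(\<lambda>(p, d). b p * d) ` ({p \<in> P. \<beta> p = i} \<times> D). q i * l = l"
      using abq(2) by (auto simp: mult.assoc[symmetric])
    show "\<forall>l\<in>(\<lambda>(p, d). d * a p) ` ({p \<in> P. \<beta> p = i} \<times> D). l * q i = l"
      using abq(1) by (auto simp: mult.assoc)
    show "finite ((\<lambda>(p, d). b p * d) ` ({p \<in> P. \<beta> p = i} \<times> D))"
      "finite ((\<lambda>(p, d). d * a p) ` ({p \<in> P. \<beta> p = i} \<times> D))" using P D by simp_all
    show "(\<lambda>(p, d). b p * d) ` ({p \<in> P. \<beta> p = i} \<times> D) \<subseteq> J"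
      using abU(2) D(2) by (auto intro: idealizer_left)
    show "(\<lambda>(p, d). d * a p) ` ({p \<in> P. \<beta> p = i} \<times> D) \<subseteq> J"
      using abU(1) D(2) by (auto intro: idealizer_right)
  qed
  then have "\<forall>i. \<exists>h. h \<in> J \<and> h * h = h \<and> q i * h = h \<and> h * q i = h
      \<and> (\<forall>l\<in>(\<lambda>(p, d). b p * d) ` ({p \<in> P. \<beta> p = i} \<times> D). h * l = l)
      \<and> (\<forall>l\<in>(\<lambda>(p, d). d * a p) ` ({p \<in> P. \<beta> p = i} \<times> D). l * h = l)" by blast
  from choice[OF this] obtain h where
    h_props: "\<forall>i. h i \<in> J \<and> h i * h i = h i \<and> q i * h i = h i \<and> h i * q i = h i
      \<and> (\<forall>l\<in>(\<lambda>(p, d). b p * d) ` ({p \<in> P. \<beta> p = i} \<times> D). h i * l = l)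
      \<and> (\<forall>l\<in>(\<lambda>(p, d). d * a p) ` ({p \<in> P. \<beta> p = i} \<times> D). l * h i = l)" by (rule exE)
  have h: "h i \<in> J" "h i * h i = h i" "q i * h i = h i" "h i * q i = h i"
    and hb': "\<forall>l\<in>(\<lambda>(p, d). b p * d) ` ({p \<in> P. \<beta> p = i} \<times> D). h i * l = l"
    and ah': "\<forall>l\<in>(\<lambda>(p, d). d * a p) ` ({p \<in> P. \<beta> p = i} \<times> D). l * h i = l" for i
    using spec[OF h_props, of i] by - (elim conjE, assumption)+
  have hb: "h (\<beta> p) * (b p * d) = b p * d" if "p \<in> P" "d \<in> D" for p d
  proof -
    have "b p * d \<in> (\<lambda>(p, d). b p * d) ` ({s \<in> P. \<beta> s = \<beta> p} \<times> D)"
      by (rule image_eqI[where x="(p, d)"]) (use that in auto)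
    then show ?thesis using bspec[OF hb'] by blast
  qed
  have ah: "d * a p * h (\<beta> p) = d * a p" if "p \<in> P" "d \<in> D" for p d
  proof -
    have "d * a p \<in> (\<lambda>(p, d). d * a p) ` ({s \<in> P. \<beta> s = \<beta> p} \<times> D)"
      by (rule image_eqI[where x="(p, d)"]) (use that in auto)
    then show ?thesis using bspec[OF ah'] by blast
  qed
  define e where "e = (\<Sum>p\<in>P. a p * h (\<beta> p) * b p)"
  have "a p * h (\<beta> p) * b p \<in> J" if "p \<in> P" for p
    using that by (intro idealizer_right[OF abU(2) idealizer_left[OF abU(1) h(1)]])
  then have eJ: "e \<in> J" unfolding e_def using J(1) by (intro subspace_sum) (simp_all add: subalg_def)
  have ea: "e * a p = a p * h (\<beta> p)" if "p \<in> P" for p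
  proof -
    have "e * a p = (\<Sum>s\<in>P. a s * h (\<beta> s) * (b s * a p))"
      by (simp add: e_def sum_distrib_right mult.assoc)
    also have "\<dots> = (\<Sum>s\<in>P. if s = p then a p * h (\<beta> p) else 0)"
      using that by (intro sum.cong) (auto simp: ba h mult.assoc)
    finally show ?thesis using that P by simp
  qed
  have be: "b p * e = h (\<beta> p) * b p" if "p \<in> P" for p
  proof -
    have "b p * e = (\<Sum>s\<in>P. b p * a s * h (\<beta> s) * b s)"
      by (simp add: e_def sum_distrib_left mult.assoc)
    also have "\<dots> = (\<Sum>s\<in>P. if s = p then h (\<beta> p) * b p else 0)"
      using that by (intro sum.cong) (auto simp: ba h)
    finally show ?thesis using that P by simp
  qed
  have ee: "e * e = e"
  proof -
    have "e * e = (\<Sum>p\<in>P. e * a p * (h (\<beta> p) * b p))"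
      by (subst (2) e_def) (simp add: sum_distrib_left mult.assoc)
    also have "\<dots> = (\<Sum>p\<in>P. a p * (h (\<beta> p) * h (\<beta> p)) * b p)"
      by (intro sum.cong) (simp_all add: ea mult.assoc del: h)
    finally show ?thesis by (simp only: h(2) e_def)
  qed
  have "e * d = d" if "d \<in> D" for d
  proof -
    have "e * d = (\<Sum>p\<in>P. a p * (h (\<beta> p) * (b p * d)))"
      by (simp add: e_def sum_distrib_right mult.assoc)
    also have "\<dots> = (\<Sum>p\<in>P. a p * b p) * d"
      using that by (simp add: hb sum_distrib_right mult.assoc)
    finally show ?thesis by (simp add: complete)
  qed
  moreover have "d * e = d" if "d \<in> D" for d
  proof -
    have "d * e = (\<Sum>p\<in>P. (d * a p * h (\<beta> p)) * b p)"
      by (simp add: e_def sum_distrib_left mult.assoc)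
    also have "\<dots> = (\<Sum>p\<in>P. d * a p * b p)"
      by (rule sum.cong) (simp_all only: ah[OF _ that])
    also have "\<dots> = d * (\<Sum>p\<in>P. a p * b p)"
      by (simp add: sum_distrib_left mult.assoc)
    finally show ?thesis by (simp add: complete)
  qed
  ultimately show ?thesis using eJ ee ea be h by blast
qed

text \<open>The subspace \<open>C\<close> is kept general: it is the ideal \<open>J\<close> in some
  uses and the corner of \<open>e\<close> in another.\<close>

lemma span_congruent:
  assumes C: "subspace C" and v: "\<And>i. i \<in> I \<Longrightarrow> v i - v' i \<in> C" and w: "w \<in> span (v ` I)"
  shows "\<exists>w'\<in>span (v' ` I). w - w' \<in> C"
  using w
proof (induction rule: span_induct_alt)
  case base
  then show ?case using subspace_0[OF C] span_zero by force
next
  case (step c x y)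
  then obtain i w' where i: "i \<in> I" "x = v i" and w': "w' \<in> span (v' ` I)" "y - w' \<in> C" by blast
  have "c *s x + y - (c *s v' i + w') = c *s (v i - v' i) + (y - w')"
    using i by (simp add: algebra_simps)
  also have "\<dots> \<in> C" using C v[OF i(1)] w' by (simp add: subspace_add subspace_scale)
  finally have "c *s x + y - (c *s v' i + w') \<in> C" .
  moreover have "c *s v' i + w' \<in> span (v' ` I)"
    using i w' by (simp add: span_add span_scale span_base)
  ultimately show ?case by blast
qed

text \<open>After the units are lifted to \<open>a p * b p'\<close>, the remainders
  \<open>f - w0 f\<close> form a finite subset of \<open>J\<close>, and \<open>e\<close> is a
  two-sided unit for it that commutes with the lifted units. Replacing these by
  \<open>(1 - e) * a p * b p'\<close> changes each \<open>w0 f\<close> only by an element of the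
  corner of \<open>e\<close>, so the remainders stay in that corner.\<close>

lemma matrix_units_lift:
  fixes x :: "'p \<Rightarrow> 'p \<Rightarrow> 'r" and \<beta> :: "'p \<Rightarrow> 'i"
  assumes J: "subalg J" "vn_regular J" and P: "finite P" and x: "matrix_units_mod J P \<beta> x"
    and x_idealizer: "\<forall>p\<in>P. \<forall>p'\<in>P. \<beta> p = \<beta> p' \<longrightarrow> x p p' \<in> idealizer J"
    and F: "finite F" "\<forall>f\<in>F. \<exists>w\<in>span ((\<lambda>(p, p'). x p p') ` same_block P \<beta>). f - w \<in> J"
  shows "\<exists>e m. e \<in> J \<and> e * e = e \<and> matrix_units_mod {0} P \<beta> m
    \<and> (\<forall>p\<in>P. \<forall>p'\<in>P. \<beta> p = \<beta> p' \<longrightarrow> m p p' - x p p' \<in> J \<and> e * m p p' = 0 \<and> m p p' * e = 0)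
    \<and> (\<forall>f\<in>F. \<exists>w\<in>span ((\<lambda>(p, p'). m p p') ` same_block P \<beta>).
         f - w \<in> J \<and> e * (f - w) = f - w \<and> (f - w) * e = f - w)"
proof -
  \<comment> \<open>An arbitrary base index in each block that meets \<open>P\<close>.\<close>
  define ob where "ob i = (SOME p. p \<in> P \<and> \<beta> p = i)" for i
  have xU: "x p p' \<in> idealizer J" if "p \<in> P" "p' \<in> P" "\<beta> p = \<beta> p'" for p p'
    using x_idealizer that by blast
  have o: "ob (\<beta> p) \<in> P \<and> \<beta> (ob (\<beta> p)) = \<beta> p" if "p \<in> P" for p
    unfolding ob_def by (rule someI[of _ p]) (simp add: that)
  then have "\<forall>p\<in>P. ob (\<beta> p) \<in> P \<and> \<beta> (ob (\<beta> p)) = \<beta> p" by blast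
  from matrix_units_partial_lift[OF J x x_idealizer this P subset_refl]
  obtain a b q where ab': "\<forall>p\<in>P. a p - x p (ob (\<beta> p)) \<in> J \<and> b p - x (ob (\<beta> p)) p \<in> J"
      "\<forall>i. q i * q i = q i \<and> q i \<in> idealizer J"
      "\<forall>p\<in>P. a p * q (\<beta> p) = a p \<and> q (\<beta> p) * b p = b p"
      "\<forall>p\<in>P. \<forall>p'\<in>P. b p * a p' = (if p = p' then q (\<beta> p) else 0)"
    by (elim exE conjE) (rule that)
  have abx: "\<And>p. p \<in> P \<Longrightarrow> a p - x p (ob (\<beta> p)) \<in> J" "\<And>p. p \<in> P \<Longrightarrow> b p - x (ob (\<beta> p)) p \<in> J"
    and q: "\<And>i. q i * q i = q i" "\<And>i. q i \<in> idealizer J"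
    and abq: "\<And>p. p \<in> P \<Longrightarrow> a p * q (\<beta> p) = a p" "\<And>p. p \<in> P \<Longrightarrow> q (\<beta> p) * b p = b p"
    and ba: "\<And>p p'. p \<in> P \<Longrightarrow> p' \<in> P \<Longrightarrow> b p * a p' = (if p = p' then q (\<beta> p) else 0)"
    using ab' by blast+
  have aU: "a p \<in> idealizer J" and bU: "b p \<in> idealizer J" if "p \<in> P" for p
    using congruent_idealizer[OF J(1)] abx[OF that] xU o[OF that] that by simp_all
  have m0x: "a p * b p' - x p p' \<in> J" if "p \<in> P" "p' \<in> P" "\<beta> p = \<beta> p'" for p p'
  proof -
    have "a p * b p' - x p (ob (\<beta> p)) * x (ob (\<beta> p')) p' \<in> J"
      using that o[of p] xU by (intro congruent_mult[OF J(1)] abx bU) auto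
    moreover have "x p (ob (\<beta> p)) * x (ob (\<beta> p)) p' - x p p' \<in> J"
      using x[unfolded matrix_units_mod_def, rule_format, of p "ob (\<beta> p)" "ob (\<beta> p)" p'] that o[of p]
      by simp
    ultimately show ?thesis using congruent_trans[OF J(1)] that by simp
  qed
  have "\<exists>w\<in>span ((\<lambda>(p, p'). a p * b p') ` same_block P \<beta>). f - w \<in> J" if fF: "f \<in> F" for f
  proof -
    obtain w where w: "w \<in> span ((\<lambda>(p, p'). x p p') ` same_block P \<beta>)" "f - w \<in> J"
      using bspec[OF F(2) fF] by (elim bexE)
    have "\<exists>w'\<in>span ((\<lambda>(p, p'). a p * b p') ` same_block P \<beta>). w - w' \<in> J"
    proof (rule span_congruent[OF _ _ w(1)])
      show "subspace J" using J(1) by (simp add: subalg_def)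
      show "(case i of (p, p') \<Rightarrow> x p p') - (case i of (p, p') \<Rightarrow> a p * b p') \<in> J"
        if "i \<in> same_block P \<beta>" for i
        using that congruent_sym[OF J(1) m0x] by (cases i) (simp add: same_block_def)
    qed
    then show ?thesis using w(2) congruent_trans[OF J(1)] by blast
  qed
  then obtain w0 where w0: "\<And>f. f \<in> F \<Longrightarrow> w0 f \<in> span ((\<lambda>(p, p'). a p * b p') ` same_block P \<beta>)"
      "\<And>f. f \<in> F \<Longrightarrow> f - w0 f \<in> J" by metis
  define D where "D = (\<lambda>f. f - w0 f) ` F"
  have D: "finite D" "D \<subseteq> J" using F w0 by (auto simp: D_def)
  define u where "u = (\<Sum>s\<in>P. a s * b s)"
  note u_facts = orthogonal_system_sum[of P b a q \<beta>, OF P ba abq, folded u_def]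
  have ua: "u * a s = a s" and bu: "b s * u = b s" if "s \<in> P" for s
    using u_facts that by blast+
  have uu: "u * u = u" using u_facts by blast
  have vU: "1 - u \<in> idealizer J"
    unfolding u_def using J aU bU by (intro idealizer_closed idealizer_sum) auto
  \<comment> \<open>The index \<open>None\<close> stands for the complement \<open>1 - u\<close> and makes the system complete.\<close>
  define P' where "P' = insert None (Some ` P)"
  define a' where "a' = case_option (1 - u) a"
  define b' where "b' = case_option (1 - u) b"
  define q' where "q' = case_option (1 - u) q"
  have "\<exists>h e. e \<in> J \<and> e * e = e \<and> (\<forall>d\<in>D. e * d = d \<and> d * e = d)
    \<and> (\<forall>i. h i \<in> J \<and> h i * h i = h i \<and> q' i * h i = h i \<and> h i * q' i = h i)
    \<and> (\<forall>p\<in>P'. e * a' p = a' p * h (map_option \<beta> p) \<and> b' p * e = h (map_option \<beta> p) * b' p)"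
  proof (rule complete_system_local_unit[OF J])
    have vv: "(1 - u) * (1 - u) = 1 - u" using uu by (simp add: algebra_simps)
    show "finite P'" using P by (simp add: P'_def)
    show "a' p \<in> idealizer J" "b' p \<in> idealizer J" if "p \<in> P'" for p
      using that vU aU bU by (auto simp: P'_def a'_def b'_def)
    show "q' i * q' i = q' i" "q' i \<in> idealizer J" for i
      using q vv vU by (auto simp: q'_def split: option.split)
    show "a' p * q' (map_option \<beta> p) = a' p" "q' (map_option \<beta> p) * b' p = b' p" if "p \<in> P'" for p
      using that abq vv by (auto simp: P'_def a'_def b'_def q'_def)
    show "b' p * a' s = (if p = s then q' (map_option \<beta> p) else 0)" if "p \<in> P'" "s \<in> P'" for p s
      using that ba vv ua bu by (auto simp: P'_def a'_def b'_def q'_def left_diff_distrib right_diff_distrib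
          split: if_splits)
    have "(\<Sum>p\<in>P'. a' p * b' p) = (1 - u) * (1 - u) + (\<Sum>p\<in>P. a p * b p)"
      unfolding P'_def using P by (simp add: sum.reindex a'_def b'_def)
    then show "(\<Sum>p\<in>P'. a' p * b' p) = 1" using vv by (simp add: u_def)
  qed (use D in auto)
  then obtain h e where e: "e \<in> J" "e * e = e" "\<forall>d\<in>D. e * d = d \<and> d * e = d"
    and h: "\<And>i. h i \<in> J \<and> h i * h i = h i \<and> q' i * h i = h i \<and> h i * q' i = h i"
    and eab: "\<And>p. p \<in> P' \<Longrightarrow> e * a' p = a' p * h (map_option \<beta> p)"
      "\<And>p. p \<in> P' \<Longrightarrow> b' p * e = h (map_option \<beta> p) * b' p" by metis
  define g where "g i = h (Some i)" for i
  have g: "g i \<in> J" "g i * g i = g i" "q i * g i = g i" "g i * q i = g i" for i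
    using h[of "Some i"] by (simp_all add: g_def q'_def)
  have ea: "e * a p = a p * g (\<beta> p)" and be: "b p * e = g (\<beta> p) * b p" if "p \<in> P" for p
    using eab[of "Some p"] that by (simp_all add: P'_def a'_def b'_def g_def)
  \<comment> \<open>Equal to \<open>(1 - e) * a p * b p'\<close>. As \<open>g i\<close> lies below
    \<open>q i\<close>, the difference \<open>q i - g i\<close> is an idempotent, possibly
    zero.\<close>
  define m where "m p p' = a p * (q (\<beta> p) - g (\<beta> p)) * b p'" for p p'
  have agb: "a p * b p' - m p p' = a p * g (\<beta> p) * b p'" if "p \<in> P" for p p'
    using abq[OF that] by (simp add: m_def algebra_simps)
  have agbJ: "a p * g (\<beta> p) * b p' \<in> J" if "p \<in> P" "p' \<in> P" for p p'
    using that by (intro idealizer_right[OF bU idealizer_left[OF aU g(1)]])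
  have m_mult: "m p p' * m s t = (if p' = s then m p t else 0)"
    if "p \<in> P" "p' \<in> P" "s \<in> P" "t \<in> P" "\<beta> p = \<beta> p'" "\<beta> s = \<beta> t" for p p' s t
  proof -
    define k where "k i = q i - g i" for i
    have k: "k i * (q i * k i) = k i" for i
      using q g by (simp add: k_def algebra_simps)
    have "m p p' * m s t = a p * (k (\<beta> p) * ((b p' * a s) * k (\<beta> s))) * b t"
      by (simp add: m_def k_def mult.assoc)
    then show ?thesis using that ba k by (auto simp: m_def k_def[symmetric])
  qed
  have m_e: "e * m p p' = 0" "m p p' * e = 0" if "p \<in> P" "p' \<in> P" "\<beta> p = \<beta> p'" for p p'
  proof -
    have "e * m p p' = (e * a p) * (q (\<beta> p) - g (\<beta> p)) * b p'" by (simp add: m_def mult.assoc)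
    also have "\<dots> = a p * (g (\<beta> p) * (q (\<beta> p) - g (\<beta> p))) * b p'"
      by (simp only: ea[OF that(1)] mult.assoc)
    finally show "e * m p p' = 0" by (simp add: right_diff_distrib g)
    have "m p p' * e = a p * ((q (\<beta> p) - g (\<beta> p)) * (b p' * e))" by (simp add: m_def mult.assoc)
    also have "\<dots> = a p * (((q (\<beta> p) - g (\<beta> p)) * g (\<beta> p)) * b p')"
      using that by (simp only: be mult.assoc)
    finally show "m p p' * e = 0" by (simp add: left_diff_distrib g)
  qed
  have m_x: "m p p' - x p p' \<in> J" if "p \<in> P" "p' \<in> P" "\<beta> p = \<beta> p'" for p p'
    using congruent_trans[OF J(1) congruent_sym[OF J(1)] m0x] agb agbJ that by metis
  let ?C = "{j \<in> J. e * j = j \<and> j * e = j}"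
  have agbC: "a p * g (\<beta> p) * b p' \<in> ?C" if "p \<in> P" "p' \<in> P" "\<beta> p = \<beta> p'" for p p'
  proof -
    have "e * (a p * g (\<beta> p) * b p') = (e * a p) * g (\<beta> p) * b p'" by (simp add: mult.assoc)
    also have "\<dots> = a p * (g (\<beta> p) * g (\<beta> p)) * b p'" by (simp only: ea[OF that(1)] mult.assoc)
    finally have "e * (a p * g (\<beta> p) * b p') = a p * g (\<beta> p) * b p'" by (simp add: g)
    moreover have "(a p * g (\<beta> p) * b p') * e = a p * (g (\<beta> p) * (b p' * e))" by (simp add: mult.assoc)
    then have "(a p * g (\<beta> p) * b p') * e = a p * ((g (\<beta> p) * g (\<beta> p)) * b p')"
      using that by (simp only: be mult.assoc)
    then have "(a p * g (\<beta> p) * b p') * e = a p * g (\<beta> p) * b p'" by (simp add: g mult.assoc)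
    ultimately show ?thesis using agbJ[OF that(1,2)] by blast
  qed
  have C: "subspace ?C" using corner_subalg[OF J(1)] by (simp add: subalg_def)
  have "\<exists>w\<in>span ((\<lambda>(p, p'). m p p') ` same_block P \<beta>). f - w \<in> ?C" if fF: "f \<in> F" for f
  proof -
    have "\<exists>w\<in>span ((\<lambda>(p, p'). m p p') ` same_block P \<beta>). w0 f - w \<in> ?C"
    proof (rule span_congruent[OF C _ w0(1)[OF fF]])
      fix i assume "i \<in> same_block P \<beta>"
      then obtain p p' where i: "i = (p, p')" "p \<in> P" "p' \<in> P" "\<beta> p = \<beta> p'"
        by (auto simp: same_block_def)
      then show "(case i of (p, p') \<Rightarrow> a p * b p') - (case i of (p, p') \<Rightarrow> m p p') \<in> ?C"
        using agbC[OF i(2-4)] by (simp only: agb prod.case)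
    qed
    then obtain w where w: "w \<in> span ((\<lambda>(p, p'). m p p') ` same_block P \<beta>)" "w0 f - w \<in> ?C" by blast
    have "f - w0 f \<in> ?C" using e w0 fF by (auto simp: D_def)
    from subspace_add[OF C this w(2)] have "f - w \<in> ?C" by simp
    then show ?thesis using w(1) by blast
  qed
  moreover have "matrix_units_mod {0} P \<beta> m"
    unfolding matrix_units_mod_def using m_mult by simp
  ultimately show ?thesis using e m_x m_e by (intro exI[of _ e] exI[of _ m]) blast
qed

end

section \<open>Extending a locally finite-dimensional regular ideal\<close>

context kalgebra
begin

lemma span_subalg:
  assumes V: "\<And>x y. x \<in> V \<Longrightarrow> y \<in> V \<Longrightarrow> x * y \<in> span V"
  shows "subalg (span V)"
proof -
  have left: "x * y \<in> span V" if "x \<in> V" "y \<in> span V" for x y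
    using that(2)
  proof (induction rule: span_induct_alt)
    case (step c v y)
    then show ?case
      using V[OF that(1)] by (simp add: distrib_left scale_mult_right span_add span_scale)
  qed (simp add: span_zero)
  have "x * y \<in> span V" if "x \<in> span V" "y \<in> span V" for x y
    using that(1)
  proof (induction rule: span_induct_alt)
    case (step c v y)
    then show ?case
      using left[OF _ that(2)] by (simp add: distrib_right scale_mult_left span_add span_scale)
  qed (simp add: span_zero)
  then show ?thesis by (simp add: subalg_def)
qed

text \<open>A nonzero element \<open>a\<close> has a nonzero entry
  \<open>m p p * a * m p' p' = c *s m p p'\<close>. Multiplying \<open>a\<close> by a suitable
  multiple of \<open>m p' p\<close> produces \<open>z\<close> with \<open>z * z = - z\<close>, and
  such a \<open>z\<close> is left quasi-regular only if it is zero. Units may vanish, so the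
  argument rests on their multiplication table and not on independence.\<close>

lemma span_matrix_units_radical_free:
  fixes m :: "'p \<Rightarrow> 'p \<Rightarrow> 'r" and \<beta> :: "'p \<Rightarrow> 'i"
  assumes P: "finite P" and m: "matrix_units_mod {0} P \<beta> m"
  defines "M \<equiv> span ((\<lambda>(p, p'). m p p') ` same_block P \<beta>)"
  shows "subalg M" "findim M" "radical_free M"
proof -
  let ?V = "(\<lambda>(p, p'). m p p') ` same_block P \<beta>"
  have mm: "m p p' * m s t = (if p' = s then m p t else 0)"
    if "p \<in> P" "p' \<in> P" "s \<in> P" "t \<in> P" "\<beta> p = \<beta> p'" "\<beta> s = \<beta> t" for p p' s t
    using m that unfolding matrix_units_mod_def by (simp add: eq_iff_diff_eq_0[symmetric])
  have mM: "m p p' \<in> M" if "p \<in> P" "p' \<in> P" "\<beta> p = \<beta> p'" for p p'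
    unfolding M_def by (rule span_base, rule image_eqI[where x="(p, p')"]) (use that in \<open>auto simp: same_block_def\<close>)
  show subalg: "subalg M"
    unfolding M_def
  proof (rule span_subalg)
    fix x y assume "x \<in> ?V" "y \<in> ?V"
    then obtain p p' s t where "x = m p p'" "y = m s t" "p \<in> P" "p' \<in> P" "s \<in> P" "t \<in> P" "\<beta> p = \<beta> p'" "\<beta> s = \<beta> t"
      by (auto simp: same_block_def)
    then show "x * y \<in> span ?V" using mm mM unfolding M_def by (simp add: span_zero)
  qed
  have "same_block P \<beta> \<subseteq> P \<times> P" by (auto simp: same_block_def)
  then have "finite (same_block P \<beta>)" using P finite_subset by blast
  then show "findim M" unfolding findim_def M_def by blast
  \<comment> \<open>The identity element of \<open>M\<close>; it splits every element of
    \<open>M\<close> into its entries.\<close>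
  define E where "E = (\<Sum>p\<in>P. m p p)"
  have units: "m s t = E * m s t \<and> m s t = m s t * E" if "s \<in> P" "t \<in> P" "\<beta> s = \<beta> t" for s t
  proof -
    have "E * m s t = (\<Sum>p\<in>P. if p = s then m s t else 0)"
      unfolding E_def sum_distrib_right using that by (intro sum.cong) (auto simp: mm)
    moreover have "m s t * E = (\<Sum>p\<in>P. if p = t then m s t else 0)"
      unfolding E_def sum_distrib_left using that by (intro sum.cong) (auto simp: mm)
    ultimately show ?thesis using P that by simp
  qed
  have EaE: "a = E * a \<and> a = a * E" if "a \<in> M" for a
    using that unfolding M_def
  proof (induction rule: span_induct_alt)
    case (step c x y)
    then obtain s t where "x = m s t" "s \<in> P" "t \<in> P" "\<beta> s = \<beta> t" by (auto simp: same_block_def)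
    then show ?case using units[of s t] step.IH
      by (simp add: distrib_left distrib_right scale_mult_left scale_mult_right)
  qed simp
  \<comment> \<open>The conditional covers entries between different blocks, which are zero.\<close>
  have corner: "\<exists>c. m p p * a * m p' p' = c *s (if \<beta> p = \<beta> p' then m p p' else 0)"
    if "p \<in> P" "p' \<in> P" "a \<in> M" for p p' a
    using that(3) unfolding M_def
  proof (induction rule: span_induct_alt)
    case base
    show ?case by (rule exI[of _ 0]) simp
  next
    case (step c x y)
    then obtain s t d where st: "x = m s t" "s \<in> P" "t \<in> P" "\<beta> s = \<beta> t"
      and d: "m p p * y * m p' p' = d *s (if \<beta> p = \<beta> p' then m p p' else 0)"
      by (auto simp: same_block_def)
    have "m p p * x * m p' p' = (if s = p \<and> t = p' then 1 else 0) *s (if \<beta> p = \<beta> p' then m p p' else 0)"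
      using st that by (auto simp: mm)
    then have "m p p * (c *s x + y) * m p' p'
        = (c * (if s = p \<and> t = p' then 1 else 0) + d) *s (if \<beta> p = \<beta> p' then m p p' else 0)"
      using d by (simp add: distrib_left distrib_right scale_mult_left scale_mult_right scale_left_distrib)
    then show ?case by blast
  qed
  show "radical_free M"
    unfolding radical_free_def
  proof (intro ballI impI, rule ccontr)
    fix a assume a: "a \<in> M" "\<forall>r\<in>M. \<exists>b\<in>M. b + r * a + b * (r * a) = 0" "a \<noteq> 0"
    have "\<exists>p\<in>P. \<exists>p'\<in>P. m p p * a * m p' p' \<noteq> 0"
    proof (rule ccontr)
      assume "\<not> ?thesis"
      then have "(\<Sum>p\<in>P. \<Sum>p'\<in>P. m p p * a * m p' p') = 0" by simp
      moreover have "E * a * E = (\<Sum>p\<in>P. \<Sum>p'\<in>P. m p p * a * m p' p')"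
        unfolding E_def by (simp add: sum_distrib_left sum_distrib_right) (rule sum.swap)
      ultimately show False using EaE[OF a(1)] a(3) by simp
    qed
    then obtain p p' where p: "p \<in> P" "p' \<in> P" "m p p * a * m p' p' \<noteq> 0" by blast
    from corner[OF p(1,2) a(1)] p(3) obtain c where
      blk: "\<beta> p = \<beta> p'" and c: "m p p * a * m p' p' = c *s m p p'" "c \<noteq> 0" "m p p' \<noteq> 0"
      by (auto split: if_splits)
    \<comment> \<open>The scalar is chosen so that \<open>- z\<close> is idempotent. Multiplying
      \<open>b + z + b * z = 0\<close> by \<open>z\<close> from the right then leaves
      \<open>z = 0\<close>.\<close>
    define r where "r = - (inverse c) *s m p' p"
    define z where "z = r * a"
    have "r \<in> M" unfolding r_def using subalg mM p blk by (simp add: subalg_scale subalg_neg)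
    then obtain b where b: "b + z + b * z = 0" using a(2) unfolding z_def by blast
    have "m p' p * a * m p' p = m p' p * (m p p * a * m p' p') * m p' p"
      using p blk by (simp add: mult.assoc mm) (simp add: mult.assoc[symmetric] mm)
    also have "\<dots> = c *s m p' p"
      using p blk by (simp add: c(1) scale_mult_left scale_mult_right mm)
    finally have cyc: "m p' p * a * m p' p = c *s m p' p" .
    have "z * z = inverse c *s inverse c *s ((m p' p * a * m p' p) * a)"
      by (simp add: z_def r_def scale_mult_left scale_mult_right mult.assoc)
    also have "\<dots> = - z" unfolding cyc using c(2) by (simp add: z_def r_def scale_mult_left mult.assoc)
    finally have zz: "z * z = - z" .
    have "(b + z + b * z) * z = b * z + z * z + b * (z * z)" by (simp add: distrib_right mult.assoc)
    then have "z = 0" using b zz by simp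
    then have "m p' p * a = 0" using c(2) by (simp add: z_def r_def scale_mult_left)
    then have "c *s m p' p = 0" using cyc by simp
    then have "m p' p = 0" using c(2) by simp
    moreover have "m p p' = m p p' * m p' p * m p p'" using p blk by (simp add: mm)
    ultimately show False using c(3) by simp
  qed
qed

text \<open>\<open>S\<close> is the direct product of \<open>T\<close> and \<open>M\<close>, so
  quasi-inverses are taken componentwise. The last conjunct records that nothing leaves the sum of
  \<open>J\<close> and the span of the given units; since the ambient ring is larger than the
  algebra under study, this is what allows \<open>S\<close> to be pulled back.\<close>

theorem extension_local_subalgebra:
  fixes x :: "'p \<Rightarrow> 'p \<Rightarrow> 'r" and \<beta> :: "'p \<Rightarrow> 'i"
  assumes J: "subalg J"
    and local: "\<And>F. finite F \<Longrightarrow> F \<subseteq> J \<Longrightarrow> \<exists>T. subalg T \<and> T \<subseteq> J \<and> F \<subseteq> T \<and> findim T \<and> vn_regular T"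
    and P: "finite P" and x: "matrix_units_mod J P \<beta> x"
    and xU: "\<forall>p\<in>P. \<forall>p'\<in>P. \<beta> p = \<beta> p' \<longrightarrow> x p p' \<in> idealizer J"
    and F: "finite F" "\<forall>f\<in>F. \<exists>w\<in>span ((\<lambda>(p, p'). x p p') ` same_block P \<beta>). f - w \<in> J"
  shows "\<exists>S. subalg S \<and> findim S \<and> vn_regular S \<and> F \<subseteq> S
    \<and> (\<forall>s\<in>S. \<exists>w\<in>span ((\<lambda>(p, p'). x p p') ` same_block P \<beta>). s - w \<in> J)"
proof -
  have reg: "vn_regular J"
    unfolding vn_regular_def
  proof
    fix a assume "a \<in> J"
    then obtain T where "T \<subseteq> J" "a \<in> T" "vn_regular T" using local[of "{a}"] by auto
    then show "\<exists>y\<in>J. a * y * a = a" unfolding vn_regular_def by blast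
  qed
  let ?V = "\<lambda>m. (\<lambda>(p, p'). m p p') ` same_block P \<beta>"
  from matrix_units_lift[OF J reg P x xU F] obtain e m where e: "e \<in> J" "e * e = e"
      and m: "matrix_units_mod {0} P \<beta> m"
      and mx: "\<forall>p\<in>P. \<forall>p'\<in>P. \<beta> p = \<beta> p' \<longrightarrow> m p p' - x p p' \<in> J \<and> e * m p p' = 0 \<and> m p p' * e = 0"
      and fw: "\<forall>f\<in>F. \<exists>w\<in>span (?V m). f - w \<in> J \<and> e * (f - w) = f - w \<and> (f - w) * e = f - w"
    by (elim exE conjE) (rule that)
  define M where "M = span (?V m)"
  note M = span_matrix_units_radical_free[OF P m, folded M_def]
  note M_reg = radical_free_imp_vn_regular[OF M]
  have Me: "e * v = 0 \<and> v * e = 0" if "v \<in> M" for v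
    using that unfolding M_def
  proof (induction rule: span_induct_alt)
    case (step c x y)
    then show ?case using mx
      by (auto simp: same_block_def distrib_left distrib_right scale_mult_left scale_mult_right)
  qed simp
  have "\<forall>f\<in>F. \<exists>w. w \<in> M \<and> f - w \<in> J \<and> e * (f - w) = f - w \<and> (f - w) * e = f - w"
    using fw unfolding M_def by blast
  from bchoice[OF this] obtain w where
    w: "\<forall>f\<in>F. w f \<in> M \<and> f - w f \<in> J \<and> e * (f - w f) = f - w f \<and> (f - w f) * e = f - w f"
    by (rule exE)
  \<comment> \<open>With \<open>e\<close> in \<open>T0\<close>, a quasi-inverse \<open>y\<close> can
    be cut to \<open>e * y * e\<close> without leaving \<open>T0\<close>, so the corner at
    \<open>e\<close> is again regular.\<close>
  obtain T0 where T0: "subalg T0" "T0 \<subseteq> J" "insert e ((\<lambda>f. f - w f) ` F) \<subseteq> T0" "findim T0" "vn_regular T0"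
    using local[of "insert e ((\<lambda>f. f - w f) ` F)"] e F(1) w by auto
  define T where "T = {t \<in> T0. e * t = t \<and> t * e = t}"
  have T: "subalg T" "vn_regular T" "findim T"
    unfolding T_def
    using corner_subalg[OF T0(1)] corner_vn_regular[OF T0(5) idealizer_incl[OF T0(1)] e(2)] T0(3,4)
    by (auto simp: findim_def)
  have TM: "t * v = 0" "v * t = 0" if "t \<in> T" "v \<in> M" for t v
  proof -
    have "t * v = t * (e * v)" using that by (simp add: T_def mult.assoc[symmetric])
    then show "t * v = 0" using Me that by simp
    have "v * t = v * (e * t)" using that by (simp add: T_def)
    then show "v * t = 0" using Me that by (simp add: mult.assoc[symmetric])
  qed
  define S where "S = {t + v | t v. t \<in> T \<and> v \<in> M}"
  have mult: "(t + v) * (t' + v') = t * t' + v * v'" if "t \<in> T" "v \<in> M" "t' \<in> T" "v' \<in> M" for t v t' v'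
    using TM that by (simp add: distrib_left distrib_right)
  have "subspace S" unfolding S_def using T M by (intro subspace_sums) (auto simp: subalg_def)
  moreover have "x * y \<in> S" if xy: "x \<in> S" "y \<in> S" for x y
  proof -
    obtain t v t' v' where tv: "x = t + v" "y = t' + v'" "t \<in> T" "v \<in> M" "t' \<in> T" "v' \<in> M"
      using xy by (auto simp: S_def)
    then have "x * y = t * t' + v * v'" using mult by simp
    moreover have "t * t' \<in> T" "v * v' \<in> M" using tv T M by (auto intro: subalg_mult)
    ultimately show ?thesis unfolding S_def by blast
  qed
  ultimately have "subalg S" by (simp add: subalg_def)
  moreover have "findim S"
  proof -
    obtain B C where BC: "finite B" "T \<subseteq> span B" "finite C" "M \<subseteq> span C"
      using T M unfolding findim_def by blast
    have "S \<subseteq> span (B \<union> C)"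
    proof
      fix s assume "s \<in> S"
      then obtain t v where "s = t + v" "t \<in> span B" "v \<in> span C" using BC by (auto simp: S_def)
      then show "s \<in> span (B \<union> C)"
        using span_mono[of B "B \<union> C"] span_mono[of C "B \<union> C"] by (auto intro: span_add)
    qed
    then show ?thesis using BC unfolding findim_def by blast
  qed
  moreover have "vn_regular S"
    unfolding vn_regular_def
  proof
    fix s assume "s \<in> S"
    then obtain t v where tv: "s = t + v" "t \<in> T" "v \<in> M" by (auto simp: S_def)
    then obtain t' v' where tv': "t' \<in> T" "t * t' * t = t" "v' \<in> M" "v * v' * v = v"
      using T M_reg unfolding vn_regular_def by blast
    have "t * t' \<in> T" "v * v' \<in> M" using tv tv' T M by (auto intro: subalg_mult)
    then have "s * (t' + v') * s = s" using tv tv' by (simp add: mult)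
    then show "\<exists>y\<in>S. s * y * s = s" using tv' by (auto simp: S_def)
  qed
  moreover have "F \<subseteq> S"
  proof
    fix f assume f: "f \<in> F"
    then have "f - w f \<in> T" "w f \<in> M" using w T0 by (auto simp: T_def)
    moreover have "f = (f - w f) + w f" by simp
    ultimately show "f \<in> S" unfolding S_def by blast
  qed
  moreover have "\<exists>w\<in>span (?V x). s - w \<in> J" if s: "s \<in> S" for s
  proof -
    obtain t v where tv: "s = t + v" "t \<in> J" "v \<in> span (?V m)"
      using s T0 by (auto simp: S_def T_def M_def)
    have "\<exists>w\<in>span (?V x). v - w \<in> J"
    proof (rule span_congruent[OF _ _ tv(3)])
      show "subspace J" using J by (simp add: subalg_def)
      show "(case i of (p, p') \<Rightarrow> m p p') - (case i of (p, p') \<Rightarrow> x p p') \<in> J"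
        if "i \<in> same_block P \<beta>" for i
        using that mx by (cases i) (simp add: same_block_def)
    qed
    then obtain w where "w \<in> span (?V x)" "v - w \<in> J" by blast
    moreover from this have "s - w \<in> J" using subalg_add[OF J tv(2), of "v - w"] tv(1) by (simp add: add_diff_eq)
    ultimately show ?thesis by blast
  qed
  ultimately show ?thesis by blast
qed

end

section \<open>Embedding an algebra into a ring of endomorphisms\<close>

definition pm_scale :: "'k::field \<Rightarrow> ('i \<Rightarrow>\<^sub>0 'k) \<Rightarrow> ('i \<Rightarrow>\<^sub>0 'k)" where
  "pm_scale c = Poly_Mapping.map ((*) c)"

lemma lookup_pm_scale [simp]: "Poly_Mapping.lookup (pm_scale c w) i = c * Poly_Mapping.lookup w i"
  by (simp add: pm_scale_def Poly_Mapping.map.rep_eq when_def)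

interpretation pm: vector_space pm_scale
  by unfold_locales (auto intro!: poly_mapping_eqI simp: lookup_add algebra_simps)

text \<open>Linear maps on the free vector space over \<open>'i\<close>. Types are nonempty, so this
  space is nonzero and \<open>0 \<noteq> 1\<close> holds even when the algebra to be embedded is
  zero.\<close>

typedef (overloaded) ('i, 'k) lin_endo =
  "{f :: ('i \<Rightarrow>\<^sub>0 'k::field) \<Rightarrow> ('i \<Rightarrow>\<^sub>0 'k).
     (\<forall>x y. f (x + y) = f x + f y) \<and> (\<forall>c x. f (pm_scale c x) = pm_scale c (f x))}"
  morphisms endo_apply Abs_lin_endo
  by (rule exI[of _ "\<lambda>_. 0"]) simp

setup_lifting type_definition_lin_endo

instantiation lin_endo :: (type, field) ring_1
begin

lift_definition zero_lin_endo :: "('a, 'b) lin_endo" is "\<lambda>_. 0" by simp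
lift_definition one_lin_endo :: "('a, 'b) lin_endo" is "\<lambda>x. x" by simp
lift_definition plus_lin_endo :: "('a, 'b) lin_endo \<Rightarrow> ('a, 'b) lin_endo \<Rightarrow> ('a, 'b) lin_endo"
  is "\<lambda>f g x. f x + g x" by (simp add: pm.scale_right_distrib)
lift_definition uminus_lin_endo :: "('a, 'b) lin_endo \<Rightarrow> ('a, 'b) lin_endo"
  is "\<lambda>f x. - f x" by simp
lift_definition minus_lin_endo :: "('a, 'b) lin_endo \<Rightarrow> ('a, 'b) lin_endo \<Rightarrow> ('a, 'b) lin_endo"
  is "\<lambda>f g x. f x - g x" by (simp add: pm.scale_right_diff_distrib)
lift_definition times_lin_endo :: "('a, 'b) lin_endo \<Rightarrow> ('a, 'b) lin_endo \<Rightarrow> ('a, 'b) lin_endo"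
  is "\<lambda>f g x. f (g x)" by simp

instance
proof
  show "(0 :: ('a, 'b) lin_endo) \<noteq> 1"
  proof (transfer, rule notI)
    assume "(\<lambda>_ :: 'a \<Rightarrow>\<^sub>0 'b. 0 :: 'a \<Rightarrow>\<^sub>0 'b) = (\<lambda>x. x)"
    then have "Poly_Mapping.single undefined (1::'b) = (0 :: 'a \<Rightarrow>\<^sub>0 'b)" by metis
    then have "Poly_Mapping.lookup (Poly_Mapping.single (undefined::'a) (1::'b)) undefined = 0"
      by (simp only: lookup_zero)
    then show False by simp
  qed
qed (transfer; auto simp: add_ac)+

end

lift_definition endo_scale :: "'k::field \<Rightarrow> ('i, 'k) lin_endo \<Rightarrow> ('i, 'k) lin_endo"
  is "\<lambda>c f x. pm_scale c (f x)" by (simp add: pm.scale_right_distrib mult.commute)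

interpretation endo: kalgebra endo_scale
  by unfold_locales (transfer; auto simp: pm.scale_right_distrib pm.scale_left_distrib)+

section \<open>Consequences of the algebra axioms\<close>

lemma is_kalgD:
  assumes "is_kalg A"
  shows "azero A \<in> acarrier A"
    and "x \<in> acarrier A \<Longrightarrow> y \<in> acarrier A \<Longrightarrow> aadd A x y \<in> acarrier A"
    and "x \<in> acarrier A \<Longrightarrow> y \<in> acarrier A \<Longrightarrow> amul A x y \<in> acarrier A"
    and "x \<in> acarrier A \<Longrightarrow> aneg A x \<in> acarrier A"
    and "x \<in> acarrier A \<Longrightarrow> asmul A c x \<in> acarrier A"
    and "x \<in> acarrier A \<Longrightarrow> y \<in> acarrier A \<Longrightarrow> w \<in> acarrier A \<Longrightarrow> aadd A (aadd A x y) w = aadd A x (aadd A y w)"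
    and "x \<in> acarrier A \<Longrightarrow> y \<in> acarrier A \<Longrightarrow> w \<in> acarrier A \<Longrightarrow> amul A (amul A x y) w = amul A x (amul A y w)"
    and "x \<in> acarrier A \<Longrightarrow> y \<in> acarrier A \<Longrightarrow> w \<in> acarrier A \<Longrightarrow> amul A x (aadd A y w) = aadd A (amul A x y) (amul A x w)"
    and "x \<in> acarrier A \<Longrightarrow> y \<in> acarrier A \<Longrightarrow> w \<in> acarrier A \<Longrightarrow> amul A (aadd A x y) w = aadd A (amul A x w) (amul A y w)"
    and "x \<in> acarrier A \<Longrightarrow> y \<in> acarrier A \<Longrightarrow> aadd A x y = aadd A y x"
    and "x \<in> acarrier A \<Longrightarrow> aadd A (azero A) x = x"
    and "x \<in> acarrier A \<Longrightarrow> aadd A (aneg A x) x = azero A"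
    and "x \<in> acarrier A \<Longrightarrow> y \<in> acarrier A \<Longrightarrow> asmul A c (aadd A x y) = aadd A (asmul A c x) (asmul A c y)"
    and "x \<in> acarrier A \<Longrightarrow> asmul A (c + d) x = aadd A (asmul A c x) (asmul A d x)"
    and "x \<in> acarrier A \<Longrightarrow> asmul A (c * d) x = asmul A c (asmul A d x)"
    and "x \<in> acarrier A \<Longrightarrow> asmul A 1 x = x"
    and "x \<in> acarrier A \<Longrightarrow> y \<in> acarrier A \<Longrightarrow> asmul A c (amul A x y) = amul A (asmul A c x) y"
    and "x \<in> acarrier A \<Longrightarrow> y \<in> acarrier A \<Longrightarrow> asmul A c (amul A x y) = amul A x (asmul A c y)"
  using assms unfolding is_kalg_def Let_def by blast+

lemma kalg_idem_zero:
  assumes "is_kalg A" "x \<in> acarrier A" "aadd A x x = x"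
  shows "x = azero A"
proof -
  note k = is_kalgD[OF assms(1)]
  have "x = aadd A (aadd A (aneg A x) x) x" using k(11,12) assms(2) by simp
  also have "\<dots> = aadd A (aneg A x) (aadd A x x)" using k(4,6) assms(2) by simp
  finally show ?thesis using k(12) assms(2,3) by simp
qed

lemma kalg_smul_zero:
  assumes "is_kalg A"
  shows "asmul A c (azero A) = azero A" "x \<in> acarrier A \<Longrightarrow> asmul A 0 x = azero A"
proof -
  note k = is_kalgD[OF assms]
  have "aadd A (asmul A c (azero A)) (asmul A c (azero A)) = asmul A c (aadd A (azero A) (azero A))"
    using k(13)[OF k(1) k(1), of c] by simp
  then show "asmul A c (azero A) = azero A"
    using k(1,5,11) by (intro kalg_idem_zero[OF assms]) simp_all
  show "asmul A 0 x = azero A" if "x \<in> acarrier A"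
    using k(14)[OF that, of 0 0] k(5)[OF that] by (intro kalg_idem_zero[OF assms]) simp_all
qed

text \<open>The coordinate \<open>None\<close> is reserved for an adjoined unit, which makes the regular representation
faithful.\<close>

lemma linear_coordinates:
  fixes A :: "('k::field, 'a, 'b) kalg_scheme"
  assumes A: "is_kalg A"
  shows "\<exists>(\<pi> :: ('a option \<Rightarrow>\<^sub>0 'k) \<Rightarrow> 'a) \<sigma>.
      (\<forall>w. \<pi> w \<in> acarrier A) \<and> (\<forall>v w. \<pi> (v + w) = aadd A (\<pi> v) (\<pi> w))
      \<and> (\<forall>c w. \<pi> (pm_scale c w) = asmul A c (\<pi> w))
      \<and> (\<forall>x\<in>acarrier A. \<forall>y\<in>acarrier A. \<sigma> (aadd A x y) = \<sigma> x + \<sigma> y)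
      \<and> (\<forall>c. \<forall>x\<in>acarrier A. \<sigma> (asmul A c x) = pm_scale c (\<sigma> x))
      \<and> (\<forall>x\<in>acarrier A. \<pi> (\<sigma> x) = x \<and> Poly_Mapping.lookup (\<sigma> x) None = 0)
      \<and> \<pi> (Poly_Mapping.single None 1) = azero A"
proof -
  note k = is_kalgD[OF A] and k0 = kalg_smul_zero[OF A]
  \<comment> \<open>The additive group of \<open>A\<close> as a commutative monoid, so that
    \<open>finprod\<close> is a finite sum in \<open>A\<close>.\<close>
  define G where "G = \<lparr>carrier = acarrier A, monoid.mult = aadd A, one = azero A\<rparr>"
  have Gs: "carrier G = acarrier A" "monoid.mult G = aadd A" "one G = azero A"
    by (simp_all add: G_def)
  interpret G: comm_monoid G
    by (rule comm_monoidI) (use k(1,2,6,10,11) in \<open>auto simp: Gs\<close>)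
  \<comment> \<open>Evaluation of a formal linear combination of elements of \<open>A\<close>; only
    coefficients at \<open>Some a\<close> with \<open>a\<close> in the carrier count.\<close>
  define \<pi> :: "('a option \<Rightarrow>\<^sub>0 'k) \<Rightarrow> 'a" where
    "\<pi> w = finprod G (\<lambda>a. asmul A (Poly_Mapping.lookup w (Some a)) a) {a \<in> acarrier A. Poly_Mapping.lookup w (Some a) \<noteq> 0}" for w
  have fin: "finite {a \<in> acarrier A. Poly_Mapping.lookup w (Some a) \<noteq> 0}" for w :: "'a option \<Rightarrow>\<^sub>0 'k"
    by (rule finite_subset[OF _ finite_vimageI[OF finite_keys[of w], of Some]]) (auto simp: in_keys_iff)
  have \<pi>_ext: "\<pi> w = finprod G (\<lambda>a. asmul A (Poly_Mapping.lookup w (Some a)) a) B"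
    if "finite B" "B \<subseteq> acarrier A" "{a \<in> acarrier A. Poly_Mapping.lookup w (Some a) \<noteq> 0} \<subseteq> B" for w B
    unfolding \<pi>_def using that k(5) k0 by (intro G.finprod_mono_neutral_cong_left) (auto simp: Gs)
  have \<pi>C: "\<pi> w \<in> acarrier A" for w
    unfolding \<pi>_def using k(5) by (intro G.finprod_closed[unfolded Gs]) auto
  have \<pi>_add: "\<pi> (v + w) = aadd A (\<pi> v) (\<pi> w)" for v w
  proof -
    let ?B = "{a \<in> acarrier A. Poly_Mapping.lookup v (Some a) \<noteq> 0} \<union> {a \<in> acarrier A. Poly_Mapping.lookup w (Some a) \<noteq> 0}"
    have B: "finite ?B" "?B \<subseteq> acarrier A" using fin by auto
    have "\<pi> (v + w) = finprod G (\<lambda>a. asmul A (Poly_Mapping.lookup (v + w) (Some a)) a) ?B"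
      by (rule \<pi>_ext[OF B]) (auto simp: lookup_add)
    also have "\<dots> = finprod G (\<lambda>a. monoid.mult G (asmul A (Poly_Mapping.lookup v (Some a)) a) (asmul A (Poly_Mapping.lookup w (Some a)) a)) ?B"
      using k(2,5,14) by (intro G.finprod_cong') (auto simp: Gs lookup_add)
    also have "\<dots> = aadd A (finprod G (\<lambda>a. asmul A (Poly_Mapping.lookup v (Some a)) a) ?B) (finprod G (\<lambda>a. asmul A (Poly_Mapping.lookup w (Some a)) a) ?B)"
      using k(5) by (subst G.finprod_multf) (auto simp: Gs)
    finally show ?thesis using \<pi>_ext[OF B, of v] \<pi>_ext[OF B, of w] by auto
  qed
  have \<pi>_scale: "\<pi> (pm_scale c w) = asmul A c (\<pi> w)" for c w
  proof -
    have hom: "finprod G (\<lambda>a. asmul A c (f a)) B = asmul A c (finprod G f B)"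
      if "finite B" "\<And>a. a \<in> B \<Longrightarrow> f a \<in> acarrier A" for f and B :: "'a set"
      using that
    proof (induction B rule: finite_induct)
      case empty
      then show ?case using k0 by (simp add: Gs)
    next
      case (insert b B)
      have "finprod G f B \<in> acarrier A" using insert G.finprod_closed[of f B] by (auto simp: Gs)
      moreover have "finprod G (\<lambda>a. asmul A c (f a)) (insert b B)
          = aadd A (asmul A c (f b)) (finprod G (\<lambda>a. asmul A c (f a)) B)"
        using insert k(5) by (subst G.finprod_insert) (auto simp: Gs)
      moreover have "finprod G f (insert b B) = aadd A (f b) (finprod G f B)"
        using insert by (subst G.finprod_insert) (auto simp: Gs)
      ultimately show ?case using insert k(13) by simp
    qed
    let ?B = "{a \<in> acarrier A. Poly_Mapping.lookup w (Some a) \<noteq> 0}"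
    have "\<pi> (pm_scale c w) = finprod G (\<lambda>a. asmul A (Poly_Mapping.lookup (pm_scale c w) (Some a)) a) ?B"
      by (rule \<pi>_ext[OF fin]) auto
    also have "\<dots> = finprod G (\<lambda>a. asmul A c (asmul A (Poly_Mapping.lookup w (Some a)) a)) ?B"
      using k(5,15) by (intro G.finprod_cong') (auto simp: Gs)
    also have "\<dots> = asmul A c (\<pi> w)" unfolding \<pi>_def using k(5) by (intro hom fin) auto
    finally show ?thesis .
  qed
  have \<pi>_single: "\<pi> (Poly_Mapping.single (Some a) 1) = a" if "a \<in> acarrier A" for a
  proof -
    have "\<pi> (Poly_Mapping.single (Some a) 1)
        = finprod G (\<lambda>b. asmul A (Poly_Mapping.lookup (Poly_Mapping.single (Some a) (1::'k)) (Some b)) b) {a}"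
      using that by (intro \<pi>_ext) (auto simp: lookup_single when_def)
    also have "\<dots> = aadd A (asmul A 1 a) (azero A)"
      using that k(5) by (subst G.finprod_insert) (auto simp: Gs)
    finally show ?thesis using k(10)[OF that k(1)] k(11,16) that by simp
  qed
  have \<pi>_0: "\<pi> 0 = azero A" using \<pi>_add[of 0 0] by (intro kalg_idem_zero[OF A \<pi>C]) simp
  \<comment> \<open>Sending \<open>x\<close> to its basis vector is not linear, but the
    discrepancies lie in \<open>N\<close>. The linear map \<open>p\<close> built below is a
    projection with kernel \<open>N\<close>, so composing with it gives a linear section
    \<open>\<sigma>\<close> of \<open>\<pi>\<close>.\<close>
  define N where "N = {w. \<pi> w = azero A \<and> Poly_Mapping.lookup w None = 0}"
  have N: "pm.subspace N"
    unfolding pm.subspace_def N_def using \<pi>_0 k(1,11) k0 by (auto simp: \<pi>_add \<pi>_scale lookup_add)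
  obtain B where B: "B \<subseteq> N" "pm.independent B" "N \<subseteq> pm.span B"
    using pm.maximal_independent_subset[of N] by blast
  interpret pp: vector_space_pair "pm_scale :: 'k \<Rightarrow> ('a option \<Rightarrow>\<^sub>0 'k) \<Rightarrow> _" "pm_scale :: 'k \<Rightarrow> ('a option \<Rightarrow>\<^sub>0 'k) \<Rightarrow> _"
    by unfold_locales
  obtain p where p: "Vector_Spaces.linear pm_scale pm_scale p"
      "\<forall>x\<in>pm.extend_basis B. p x = (if x \<in> B then 0 else x)"
    using pp.linear_independent_extend[OF pm.independent_extend_basis[OF B(2)], of "\<lambda>x. if x \<in> B then 0 else x"]
    by (elim exE conjE)
  interpret p: Vector_Spaces.linear pm_scale pm_scale p by (rule p(1))
  have p_diff: "w - p w \<in> N" for w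
  proof -
    have "w \<in> pm.span (pm.extend_basis B)" using B(2) by simp
    then show ?thesis
    proof (induction rule: pm.span_induct_alt)
      case base
      then show ?case using pm.subspace_0[OF N] by (simp add: p.zero)
    next
      case (step c x y)
      have "x - p x \<in> N" using step(1) p(2) B(1) pm.subspace_0[OF N] by auto
      moreover have "pm_scale c x + y - p (pm_scale c x + y) = pm_scale c (x - p x) + (y - p y)"
        by (simp add: p.add p.scale algebra_simps pm.scale_right_diff_distrib)
      ultimately show ?case using step(2) N by (simp only: pm.subspace_add pm.subspace_scale)
    qed
  qed
  have p_N: "p w = 0" if "w \<in> N" for w
  proof -
    have "w \<in> pm.span B" using that B by blast
    then show ?thesis
    proof (induction rule: pm.span_induct_alt)
      case (step c x y)
      have "x \<in> pm.extend_basis B" using pm.extend_basis_superset[OF B(2)] step(1) by blast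
      then show ?case using step p(2) by (simp add: p.add p.scale)
    qed (simp add: p.zero)
  qed
  define \<sigma> where "\<sigma> x = p (Poly_Mapping.single (Some x) 1)" for x
  have \<pi>_diff: "\<pi> (v - w) = azero A" if "\<pi> v = \<pi> w" for v w
  proof -
    have "aadd A (\<pi> (v - w)) (\<pi> w) = \<pi> w" using \<pi>_add[of "v - w" w] that by simp
    then have "aadd A (aadd A (\<pi> (v - w)) (\<pi> w)) (aneg A (\<pi> w)) = aadd A (\<pi> w) (aneg A (\<pi> w))" by simp
    moreover have "aadd A (\<pi> w) (aneg A (\<pi> w)) = azero A" using k(4,10,12) \<pi>C by metis
    ultimately have "aadd A (\<pi> (v - w)) (azero A) = azero A" using k(4,6) \<pi>C by metis
    then show ?thesis using k(1,10,11) \<pi>C by metis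
  qed
  have \<pi>\<sigma>: "\<pi> (\<sigma> x) = x \<and> Poly_Mapping.lookup (\<sigma> x) None = 0" if "x \<in> acarrier A" for x
  proof -
    let ?s = "Poly_Mapping.single (Some x) (1::'k)"
    have "?s - \<sigma> x \<in> N" unfolding \<sigma>_def by (rule p_diff)
    then have "\<pi> (?s - \<sigma> x) = azero A" "Poly_Mapping.lookup (?s - \<sigma> x) None = 0" by (auto simp: N_def)
    moreover have "\<pi> ?s = aadd A (\<pi> (?s - \<sigma> x)) (\<pi> (\<sigma> x))" using \<pi>_add[of "?s - \<sigma> x" "\<sigma> x"] by simp
    ultimately show ?thesis using \<pi>_single[OF that] k(11) \<pi>C by (simp add: lookup_minus lookup_single)
  qed
  have eq: "p v = p w" if "\<pi> v = \<pi> w" "Poly_Mapping.lookup v None = Poly_Mapping.lookup w None" for v w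
  proof -
    have "v - w \<in> N" using \<pi>_diff[OF that(1)] that(2) by (simp add: N_def lookup_minus)
    then show ?thesis using p_N[of "v - w"] by (simp add: p.diff)
  qed
  have "\<sigma> (aadd A x y) = \<sigma> x + \<sigma> y" if "x \<in> acarrier A" "y \<in> acarrier A" for x y
    unfolding \<sigma>_def p.add[symmetric]
    using that k(2) by (intro eq) (simp_all add: \<pi>_add \<pi>_single lookup_add lookup_single)
  moreover have "\<sigma> (asmul A c x) = pm_scale c (\<sigma> x)" if "x \<in> acarrier A" for c x
    unfolding \<sigma>_def p.scale[symmetric]
    using that k(5) by (intro eq) (simp_all add: \<pi>_scale \<pi>_single lookup_single)
  moreover have "\<pi> (Poly_Mapping.single None 1) = azero A"
    unfolding \<pi>_def by (simp add: lookup_single Gs)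
  ultimately show ?thesis using \<pi>C \<pi>_add \<pi>_scale \<pi>\<sigma> by (intro exI[of _ \<pi>] exI[of _ \<sigma>]) blast
qed

text \<open>The left regular representation on the unitization. The maps \<open>\<sigma>\<close> and
  \<open>\<pi>\<close> carry it to the free space, and evaluation at the adjoined unit returns
  \<open>\<sigma> r\<close>, which gives injectivity.\<close>

theorem kalg_embedding:
  fixes A :: "('k::field, 'a, 'b) kalg_scheme"
  assumes A: "is_kalg A"
  shows "\<exists>\<phi> :: 'a \<Rightarrow> ('a option, 'k) lin_endo. inj_on \<phi> (acarrier A)
      \<and> (\<forall>x\<in>acarrier A. \<forall>y\<in>acarrier A. \<phi> (aadd A x y) = \<phi> x + \<phi> y \<and> \<phi> (amul A x y) = \<phi> x * \<phi> y)
      \<and> (\<forall>c. \<forall>x\<in>acarrier A. \<phi> (asmul A c x) = endo_scale c (\<phi> x))"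
proof -
  note k = is_kalgD[OF A]
  from linear_coordinates[OF A] obtain \<pi> :: "('a option \<Rightarrow>\<^sub>0 'k) \<Rightarrow> 'a" and \<sigma> where
      \<pi>': "\<forall>w. \<pi> w \<in> acarrier A" "\<forall>v w. \<pi> (v + w) = aadd A (\<pi> v) (\<pi> w)"
        "\<forall>c w. \<pi> (pm_scale c w) = asmul A c (\<pi> w)"
      and \<sigma>': "\<forall>x\<in>acarrier A. \<forall>y\<in>acarrier A. \<sigma> (aadd A x y) = \<sigma> x + \<sigma> y"
        "\<forall>c. \<forall>x\<in>acarrier A. \<sigma> (asmul A c x) = pm_scale c (\<sigma> x)"
        "\<forall>x\<in>acarrier A. \<pi> (\<sigma> x) = x \<and> Poly_Mapping.lookup (\<sigma> x) None = 0"
      and \<pi>_None: "\<pi> (Poly_Mapping.single None 1) = azero A"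
    by (elim exE conjE) (rule that)
  note \<pi> = \<pi>'[rule_format]
  have \<sigma>: "x \<in> acarrier A \<Longrightarrow> y \<in> acarrier A \<Longrightarrow> \<sigma> (aadd A x y) = \<sigma> x + \<sigma> y"
      "x \<in> acarrier A \<Longrightarrow> \<sigma> (asmul A c x) = pm_scale c (\<sigma> x)"
      "x \<in> acarrier A \<Longrightarrow> \<pi> (\<sigma> x) = x" "x \<in> acarrier A \<Longrightarrow> Poly_Mapping.lookup (\<sigma> x) None = 0" for x y c
    using \<sigma>' by blast+
  have amul_zero: "amul A r (azero A) = azero A" if "r \<in> acarrier A" for r
    using k(18)[OF that k(1), of 0] kalg_smul_zero[OF A] k(1,3) that by simp
  \<comment> \<open>The vector \<open>w\<close> represents \<open>\<pi> w\<close> plus its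
    \<open>None\<close> coordinate times the adjoined unit, and \<open>act r w\<close> is the
    product of \<open>r\<close> with that element. The product lies in \<open>A\<close>, so its
    image under \<open>\<sigma>\<close> has \<open>None\<close> coordinate \<open>0\<close>; this
    makes the representation multiplicative.\<close>
  define act where "act r w = aadd A (amul A r (\<pi> w)) (asmul A (Poly_Mapping.lookup w None) r)" for r w
  have ac: "aadd A (aadd A a b) (aadd A c d) = aadd A (aadd A a c) (aadd A b d)"
    if "a \<in> acarrier A" "b \<in> acarrier A" "c \<in> acarrier A" "d \<in> acarrier A" for a b c d
    using that k(2,6,10) by metis
  have actC: "act r w \<in> acarrier A" if "r \<in> acarrier A" for r w
    using that k(2,3,5) \<pi> by (simp add: act_def)
  have act_add: "act r (v + w) = aadd A (act r v) (act r w)" if "r \<in> acarrier A" for r v w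
    using that k(2,3,5,8,14) \<pi> by (simp add: act_def lookup_add ac)
  have act_scale: "act r (pm_scale c w) = asmul A c (act r w)" if "r \<in> acarrier A" for r c w
    using that k(2-5,13,15) k(18)[OF that, of _ c, symmetric] \<pi> by (simp add: act_def)
  have act_plus: "act (aadd A r s) w = aadd A (act r w) (act s w)"
    if "r \<in> acarrier A" "s \<in> acarrier A" for r s w
    using that k(2,3,5,9,13) \<pi> by (simp add: act_def ac)
  have act_smul: "act (asmul A c r) w = asmul A c (act r w)" if "r \<in> acarrier A" for r c w
    using that k(2-5,13) k(17)[OF that, of _ c, symmetric] k(15)[OF that, symmetric] \<pi>
    by (simp add: act_def mult.commute)
  have act_mult: "act (amul A r s) w = act r (\<sigma> (act s w))"
    if "r \<in> acarrier A" "s \<in> acarrier A" for r s w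
  proof -
    have "act r (\<sigma> (act s w)) = amul A r (act s w)"
      unfolding act_def[of r] using that \<sigma>(3,4)[OF actC] kalg_smul_zero[OF A]
        k(10)[of _ "azero A"] k(11) k(1) k(3) actC by simp
    then show ?thesis using that k(2,3,5,7,8,18) \<pi> by (simp add: act_def)
  qed
  define \<phi> where "\<phi> r = Abs_lin_endo (\<lambda>w. \<sigma> (act r w))" for r
  have app: "endo_apply (\<phi> r) = (\<lambda>w. \<sigma> (act r w))" if "r \<in> acarrier A" for r
    unfolding \<phi>_def
    by (rule Abs_lin_endo_inverse) (use that in \<open>simp add: act_add act_scale \<sigma> actC\<close>)
  have "inj_on \<phi> (acarrier A)"
  proof (rule inj_onI)
    fix r s assume rs: "r \<in> acarrier A" "s \<in> acarrier A" "\<phi> r = \<phi> s"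
    have val: "\<sigma> (act r (Poly_Mapping.single None 1)) = \<sigma> r" if "r \<in> acarrier A" for r
      using that \<pi>_None amul_zero k(11,16) by (simp add: act_def)
    have "\<sigma> r = \<sigma> s" using app[OF rs(1)] app[OF rs(2)] rs(3) val rs(1,2) by metis
    then show "r = s" using \<sigma>(3) rs by metis
  qed
  moreover have "\<phi> (aadd A x y) = \<phi> x + \<phi> y" "\<phi> (amul A x y) = \<phi> x * \<phi> y"
    if "x \<in> acarrier A" "y \<in> acarrier A" for x y
    using that k(2,3) app
    by (simp_all add: endo_apply_inject[symmetric] plus_lin_endo.rep_eq times_lin_endo.rep_eq act_plus act_mult \<sigma> actC)
  moreover have "\<phi> (asmul A c x) = endo_scale c (\<phi> x)" if "x \<in> acarrier A" for c x
    using that k(5) app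
    by (simp add: endo_apply_inject[symmetric] endo_scale.rep_eq act_smul \<sigma> actC)
  ultimately show ?thesis by blast
qed

section \<open>Matrix units modulo an ideal\<close>

definition mat_unit :: "nat \<Rightarrow> nat \<Rightarrow> nat \<Rightarrow> nat \<Rightarrow> nat \<Rightarrow> nat \<Rightarrow> 'k::field" where
  "mat_unit i r c = (\<lambda>i' r' c'. if i' = i \<and> r' = r \<and> c' = c then 1 else 0)"

lemma mat_unit_carrier:
  "i < k \<Longrightarrow> r < n i \<Longrightarrow> c < n i \<Longrightarrow> mat_unit i r c \<in> acarrier (mat_alg k n)"
  by (auto simp: mat_alg_def mat_unit_def)

text \<open>The bound keeps the only contributing summation index \<open>j = c\<close> inside the
  range.\<close>

lemma mat_unit_mult:
  assumes "c < n i"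
  shows "amul (mat_alg k n) (mat_unit i r c) (mat_unit i' r' c')
    = (if (i, c) = (i', r') then mat_unit i r c' else (\<lambda>i r c. 0))"
proof (intro ext)
  fix i0 r0 c0
  have "amul (mat_alg k n) (mat_unit i r c) (mat_unit i' r' c') i0 r0 c0
      = (\<Sum>j<n i0. if j = c then (if i0 = i \<and> r0 = r \<and> i0 = i' \<and> c = r' \<and> c0 = c' then 1 else 0) else 0 :: 'a)"
    by (simp only: mat_alg_def kalg.select_convs, rule sum.cong) (auto simp: mat_unit_def)
  also have "\<dots> = (if (i, c) = (i', r') then mat_unit i r c' else (\<lambda>i r c. 0)) i0 r0 c0"
    using assms by (auto simp: mat_unit_def)
  finally show "amul (mat_alg k n) (mat_unit i r c) (mat_unit i' r' c') i0 r0 c0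
    = (if (i, c) = (i', r') then mat_unit i r c' else (\<lambda>i r c. 0 :: 'a)) i0 r0 c0" .
qed

lemma mat_alg_kspan:
  assumes G: "G \<in> acarrier (mat_alg k n)"
  shows "G \<in> kspan (mat_alg k n) ((\<lambda>(i, r, c). mat_unit i r c) ` (SIGMA i:{..<k}. {..<n i} \<times> {..<n i}))"
proof -
  let ?T = "SIGMA i:{..<k}. {..<n i} \<times> {..<n i}"
  let ?K = "kspan (mat_alg k n) ((\<lambda>(i, r, c). mat_unit i r c) ` ?T)"
  \<comment> \<open>The entries of \<open>G\<close> are restored one at a time; outside
    \<open>?T\<close> they vanish by membership in the carrier.\<close>
  have "(\<lambda>i r c. if (i, r, c) \<in> T then G i r c else 0) \<in> ?K" if "finite T" "T \<subseteq> ?T" for T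
    using that
  proof (induction T rule: finite_induct)
    case empty
    then show ?case using kspan_zero[of "mat_alg k n"] by (simp add: mat_alg_def)
  next
    case (insert t T)
    obtain i r c where t: "t = (i, r, c)" by (cases t)
    have "mat_unit i r c \<in> ?K"
      by (rule kspan_gen, rule image_eqI[where x=t]) (use insert t in auto)
    then have "aadd (mat_alg k n) (asmul (mat_alg k n) (G i r c) (mat_unit i r c))
        (\<lambda>i r c. if (i, r, c) \<in> T then G i r c else 0) \<in> ?K"
      using insert by (intro kspan_add kspan_smul) auto
    also have "aadd (mat_alg k n) (asmul (mat_alg k n) (G i r c) (mat_unit i r c))
        (\<lambda>i r c. if (i, r, c) \<in> T then G i r c else 0)
        = (\<lambda>i r c. if (i, r, c) \<in> insert t T then G i r c else 0)"
      using insert(2) t by (auto simp: mat_alg_def mat_unit_def fun_eq_iff)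
    finally show ?case .
  qed
  from this[of ?T] have "(\<lambda>i r c. if (i, r, c) \<in> ?T then G i r c else 0) \<in> ?K" by simp
  moreover have "(\<lambda>i r c. if (i, r, c) \<in> ?T then G i r c else 0) = G"
    using G by (auto simp: mat_alg_def fun_eq_iff not_less)
  ultimately show ?thesis by simp
qed

section \<open>Cosets of an ideal\<close>

context
  fixes R :: "('k::field, 'a) kalg" and J :: "'a set"
  assumes R: "is_kalg R" and J: "kalg_ideal J R"
begin

lemma ideal_closed:
  "J \<subseteq> acarrier R" "azero R \<in> J" "x \<in> J \<Longrightarrow> y \<in> J \<Longrightarrow> aadd R x y \<in> J"
  "x \<in> J \<Longrightarrow> aneg R x \<in> J" "x \<in> J \<Longrightarrow> asmul R c x \<in> J"
  "x \<in> acarrier R \<Longrightarrow> y \<in> J \<Longrightarrow> amul R x y \<in> J" "x \<in> acarrier R \<Longrightarrow> y \<in> J \<Longrightarrow> amul R y x \<in> J"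
  using J unfolding kalg_ideal_def by blast+

lemma kcoset_eqI:
  assumes "y \<in> acarrier R" "j \<in> J"
  shows "kcoset R J (aadd R y j) = kcoset R J y"
proof -
  note k = is_kalgD[OF R] and i = ideal_closed
  have "aadd R (aadd R y j) j' = aadd R y (aadd R j j')" if "j' \<in> J" for j'
    using that assms i(1) k(6) by blast
  moreover have "aadd R y j' = aadd R (aadd R y j) (aadd R (aneg R j) j')" if "j' \<in> J" for j'
  proof -
    have C: "j \<in> acarrier R" "j' \<in> acarrier R" using that assms i(1) by auto
    have "aadd R (aadd R y j) (aadd R (aneg R j) j') = aadd R y (aadd R (aadd R j (aneg R j)) j')"
      using C assms k(2,4,6) by simp
    also have "aadd R j (aneg R j) = azero R" using C k(4,10,12) by metis
    finally show ?thesis using C k(11) by simp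
  qed
  ultimately show ?thesis unfolding kcoset_def using i(3,4) assms(2) by blast
qed

lemma kcoset_eqD:
  assumes "x \<in> acarrier R" "kcoset R J x = kcoset R J y"
  shows "\<exists>j\<in>J. x = aadd R y j"
proof -
  note k = is_kalgD[OF R]
  have "x = aadd R x (azero R)" using assms(1) k(1,10,11) by metis
  then have "x \<in> kcoset R J x" unfolding kcoset_def using ideal_closed(2) by blast
  then have "x \<in> kcoset R J y" using assms(2) by simp
  then show ?thesis unfolding kcoset_def by blast
qed

lemma kcoset_rep:
  assumes "X \<in> kcoset R J ` acarrier R"
  shows "(SOME x. x \<in> X) \<in> acarrier R" "kcoset R J (SOME x. x \<in> X) = X"
proof -
  note k = is_kalgD[OF R]
  obtain z where z: "z \<in> acarrier R" "X = kcoset R J z" using assms by blast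
  have "aadd R z (azero R) \<in> X" unfolding z kcoset_def using ideal_closed(2) by blast
  then have "(SOME x. x \<in> X) \<in> X" by (rule someI)
  then obtain j where j: "j \<in> J" "(SOME x. x \<in> X) = aadd R z j" unfolding z kcoset_def by blast
  show "(SOME x. x \<in> X) \<in> acarrier R" using j z k(2) ideal_closed(1) by auto
  show "kcoset R J (SOME x. x \<in> X) = X" using j z kcoset_eqI by simp
qed

lemma kcoset_aadd:
  assumes "x \<in> acarrier R" "y \<in> acarrier R" "x' \<in> acarrier R" "y' \<in> acarrier R"
    "kcoset R J x = kcoset R J x'" "kcoset R J y = kcoset R J y'"
  shows "kcoset R J (aadd R x y) = kcoset R J (aadd R x' y')"
proof -
  note k = is_kalgD[OF R]
  obtain i j where ij: "i \<in> J" "x = aadd R x' i" "j \<in> J" "y = aadd R y' j"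
    using kcoset_eqD assms by metis
  then have C: "i \<in> acarrier R" "j \<in> acarrier R" using ideal_closed(1) by auto
  have "aadd R x y = aadd R (aadd R x' y') (aadd R i j)"
    unfolding ij(2,4) using C assms(3,4) k(2,6,10) by metis
  then show ?thesis using kcoset_eqI k(2) assms ideal_closed(3) ij by simp
qed

lemma kcoset_asmul:
  assumes "x \<in> acarrier R" "x' \<in> acarrier R" "kcoset R J x = kcoset R J x'"
  shows "kcoset R J (asmul R c x) = kcoset R J (asmul R c x')"
proof -
  note k = is_kalgD[OF R]
  obtain i where i: "i \<in> J" "x = aadd R x' i" using kcoset_eqD assms by metis
  then have "asmul R c x = aadd R (asmul R c x') (asmul R c i)"
    using k(13) assms(2) ideal_closed(1) by auto
  then show ?thesis using kcoset_eqI k(5) assms ideal_closed(5) i by simp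
qed

text \<open>The lift uses the representatives that \<open>quot_alg\<close> itself chooses, so one
  family in \<open>R\<close> serves all elements \<open>Y\<close> of the span.\<close>

lemma quot_kspan:
  assumes X: "\<And>i. i \<in> I \<Longrightarrow> X i \<in> acarrier (quot_alg R J)"
    and Y: "Y \<in> kspan (quot_alg R J) (X ` I)"
  shows "\<exists>w\<in>kspan R ((\<lambda>i. SOME x. x \<in> X i) ` I). w \<in> acarrier R \<and> Y = kcoset R J w"
  using Y
proof induction
  case kspan_zero
  have "azero R \<in> kspan R ((\<lambda>i. SOME x. x \<in> X i) ` I)" by (rule kspan.kspan_zero)
  then show ?case using is_kalgD(1)[OF R] by (auto simp: quot_alg_def Let_def)
next
  case (kspan_gen b)
  then obtain i where i: "i \<in> I" "b = X i" by blast
  then have "(SOME x. x \<in> X i) \<in> kspan R ((\<lambda>i. SOME x. x \<in> X i) ` I)" by (intro kspan.kspan_gen) blast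
  moreover have "X i \<in> kcoset R J ` acarrier R" using X[OF i(1)] by (simp add: quot_alg_def Let_def)
  ultimately show ?case using kcoset_rep[of "X i"] i by auto
next
  case (kspan_add x y)
  then obtain v w where v: "v \<in> kspan R ((\<lambda>i. SOME x. x \<in> X i) ` I)" "v \<in> acarrier R" "x = kcoset R J v"
    and w: "w \<in> kspan R ((\<lambda>i. SOME x. x \<in> X i) ` I)" "w \<in> acarrier R" "y = kcoset R J w" by blast
  have "aadd (quot_alg R J) x y = kcoset R J (aadd R (SOME a. a \<in> x) (SOME a. a \<in> y))"
    by (simp add: quot_alg_def Let_def)
  also have "\<dots> = kcoset R J (aadd R v w)"
    by (rule kcoset_aadd) (use kcoset_rep[of x] kcoset_rep[of y] v w in auto)
  finally show ?case using kspan.kspan_add[OF v(1) w(1)] is_kalgD(2)[OF R v(2) w(2)] by blast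
next
  case (kspan_smul x c)
  then obtain v where v: "v \<in> kspan R ((\<lambda>i. SOME x. x \<in> X i) ` I)" "v \<in> acarrier R" "x = kcoset R J v"
    by blast
  have "asmul (quot_alg R J) c x = kcoset R J (asmul R c (SOME a. a \<in> x))"
    by (simp add: quot_alg_def Let_def)
  also have "\<dots> = kcoset R J (asmul R c v)"
    by (rule kcoset_asmul) (use kcoset_rep[of x] v in auto)
  finally show ?case using kspan.kspan_smul[OF v(1), of c] is_kalgD(5)[OF R v(2), of c] by blast
qed

text \<open>Translating the hypothesis on the quotient into relations in \<open>R\<close> modulo
  \<open>J\<close> means that only \<open>R\<close> has to be embedded into an endomorphism
  ring.\<close>

lemma quotient_matrix_units:
  assumes M: "locally_matricial (quot_alg R J)" and F: "finite F" "F \<subseteq> acarrier R"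
  shows "\<exists>(P :: (nat \<times> nat) set) x. finite P
    \<and> (\<forall>(p, p')\<in>same_block P fst. x p p' \<in> acarrier R)
    \<and> (\<forall>(p, p')\<in>same_block P fst. \<forall>(s, t)\<in>same_block P fst.
         \<exists>j\<in>J. amul R (x p p') (x s t) = aadd R (if p' = s then x p t else azero R) j)
    \<and> (\<forall>f\<in>F. \<exists>w\<in>kspan R ((\<lambda>(p, p'). x p p') ` same_block P fst). \<exists>j\<in>J. f = aadd R w j)"
proof -
  let ?Q = "quot_alg R J"
  have Q_car: "acarrier ?Q = kcoset R J ` acarrier R" by (simp add: quot_alg_def Let_def)
  have "finite (kcoset R J ` F)" "kcoset R J ` F \<subseteq> acarrier ?Q"
    using F by (auto simp: Q_car)
  then obtain S where S: "kalg_subalgebra S ?Q" "kcoset R J ` F \<subseteq> S" "matricial (?Q\<lparr>acarrier := S\<rparr>)"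
    using M unfolding locally_matricial_def by meson
  then obtain k n h where QS: "is_kalg (?Q\<lparr>acarrier := S\<rparr>)"
      and h: "kalg_iso (?Q\<lparr>acarrier := S\<rparr>) (mat_alg k n :: ('k, nat \<Rightarrow> nat \<Rightarrow> nat \<Rightarrow> 'k) kalg) h"
    unfolding matricial_def by blast
  let ?M = "mat_alg k n :: ('k, nat \<Rightarrow> nat \<Rightarrow> nat \<Rightarrow> 'k) kalg"
  note kS = is_kalgD[OF QS, simplified]
  have SQ: "S \<subseteq> acarrier ?Q" using S by (simp add: kalg_subalgebra_def)
  have bij: "bij_betw h S (acarrier ?M)"
    and h_add: "\<And>x y. x \<in> S \<Longrightarrow> y \<in> S \<Longrightarrow> h (aadd ?Q x y) = aadd ?M (h x) (h y)"
    and h_mul: "\<And>x y. x \<in> S \<Longrightarrow> y \<in> S \<Longrightarrow> h (amul ?Q x y) = amul ?M (h x) (h y)"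
    and h_smul: "\<And>c x. x \<in> S \<Longrightarrow> h (asmul ?Q c x) = asmul ?M c (h x)"
    using h by (simp_all add: kalg_iso_def)
  have inj: "inj_on h S" using bij by (rule bij_betw_imp_inj_on)
  define g where "g = inv_into S h"
  have gS: "g G \<in> S" and hg: "h (g G) = G" if "G \<in> acarrier ?M" for G
    using bij that unfolding g_def by (auto simp: bij_betw_def inv_into_into f_inv_into_f)
  have gh: "g (h Y) = Y" if "Y \<in> S" for Y
    using inj that by (simp add: g_def)
  \<comment> \<open>Zero is recovered from additivity: \<open>aadd ?Q Z Z = Z\<close> forces
    \<open>Z\<close> to be zero.\<close>
  have h_zero: "Z = azero ?Q" if "Z \<in> S" "h Z = azero ?M" for Z
  proof -
    have "h (aadd ?Q Z Z) = h Z" using that h_add by (simp add: mat_alg_def)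
    then have "aadd ?Q Z Z = Z" using inj_onD[OF inj _ kS(2)[OF that(1) that(1)] that(1)] by blast
    then show ?thesis using kalg_idem_zero[OF QS, of Z] that by simp
  qed
  \<comment> \<open>The index \<open>(i, r)\<close> is row \<open>r\<close> of block
    \<open>i\<close>, so \<open>fst\<close> is the block map.\<close>
  define P where "P = (SIGMA i:{..<k}. {..<n i})"
  define X where "X p p' = g (mat_unit (fst p) (snd p) (snd p'))" for p p' :: "nat \<times> nat"
  \<comment> \<open>The same choice of representative as in \<open>quot_alg\<close>, so the product
    of two cosets \<open>X\<close> is by definition the coset of the product of the corresponding
    \<open>x\<close>.\<close>
  define x where "x p p' = (SOME y. y \<in> X p p')" for p p'
  have unit: "mat_unit (fst p) (snd p) (snd p') \<in> acarrier ?M" if "(p, p') \<in> same_block P fst" for p p'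
    using that by (auto simp: same_block_def P_def intro!: mat_unit_carrier)
  have XS: "X p p' \<in> S" if "(p, p') \<in> same_block P fst" for p p'
    unfolding X_def using gS unit that by blast
  have x: "x p p' \<in> acarrier R" "kcoset R J (x p p') = X p p'" if "(p, p') \<in> same_block P fst" for p p'
    using kcoset_rep[of "X p p'"] XS[OF that] SQ unfolding x_def Q_car by auto
  have "finite P" by (simp add: P_def)
  moreover have "\<exists>j\<in>J. amul R (x p p') (x s t) = aadd R (if p' = s then x p t else azero R) j"
    if st: "(p, p') \<in> same_block P fst" "(s, t) \<in> same_block P fst" for p p' s t
  proof (rule kcoset_eqD)
    show "amul R (x p p') (x s t) \<in> acarrier R" using x st is_kalgD(3)[OF R] by blast
    have "kcoset R J (amul R (x p p') (x s t)) = amul ?Q (X p p') (X s t)"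
      by (simp add: x_def quot_alg_def Let_def)
    also have "\<dots> = kcoset R J (if p' = s then x p t else azero R)"
    proof -
      let ?Z = "amul ?Q (X p p') (X s t)"
      have ZS: "?Z \<in> S" using XS st kS(3) by blast
      have "h ?Z = amul ?M (mat_unit (fst p) (snd p) (snd p')) (mat_unit (fst s) (snd s) (snd t))"
        using h_mul XS st unit hg by (simp add: X_def)
      also have "\<dots> = (if p' = s then mat_unit (fst p) (snd p) (snd t) else azero ?M)"
        using st by (subst mat_unit_mult) (auto simp: same_block_def P_def mat_alg_def prod_eq_iff)
      finally have hZ: "h ?Z = (if p' = s then mat_unit (fst p) (snd p) (snd t) else azero ?M)" .
      show ?thesis
      proof (cases "p' = s")
        case True
        then have "(p, t) \<in> same_block P fst" using st by (auto simp: same_block_def)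
        moreover have "?Z = X p t" using hZ True gh[OF ZS] by (simp add: X_def)
        ultimately show ?thesis using x True by simp
      next
        case False
        then have "?Z = azero ?Q" using hZ h_zero[OF ZS] by simp
        then show ?thesis using False by (simp add: quot_alg_def Let_def)
      qed
    qed
    finally show "kcoset R J (amul R (x p p') (x s t)) = kcoset R J (if p' = s then x p t else azero R)" .
  qed
  moreover have "\<exists>w\<in>kspan R ((\<lambda>(p, p'). x p p') ` same_block P fst). \<exists>j\<in>J. f = aadd R w j" if f: "f \<in> F" for f
  proof -
    let ?V = "(\<lambda>(p, p'). X p p') ` same_block P fst"
    \<comment> \<open>\<open>g\<close> inverts \<open>h\<close> only on the carrier, hence the
      carrier membership carried along in the induction.\<close>
    have "G \<in> acarrier ?M \<and> g G \<in> kspan ?Q ?V"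
      if "G \<in> kspan ?M ((\<lambda>(i, r, c). mat_unit i r c) ` (SIGMA i:{..<k}. {..<n i} \<times> {..<n i}))" for G
      using that
    proof induction
      case kspan_zero
      have z: "azero ?M \<in> acarrier ?M" by (simp add: mat_alg_def)
      then have "g (azero ?M) = azero ?Q" using h_zero gS hg by blast
      then show ?case using z kspan.kspan_zero[of ?Q] by metis
    next
      case (kspan_gen b)
      then obtain i r c where b: "b = mat_unit i r c" "i < k" "r < n i" "c < n i" by auto
      then have "((i, r), (i, c)) \<in> same_block P fst" by (simp add: same_block_def P_def)
      then have "X (i, r) (i, c) \<in> ?V" by (rule image_eqI[rotated]) simp
      then have "g b \<in> ?V" using b by (simp add: X_def)
      moreover have "b \<in> acarrier ?M" unfolding b(1) using b(2-4) by (rule mat_unit_carrier)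
      ultimately show ?case by (auto intro: kspan.kspan_gen)
    next
      case (kspan_add u v)
      then have C: "u \<in> acarrier ?M" "v \<in> acarrier ?M" by blast+
      then have "h (aadd ?Q (g u) (g v)) = aadd ?M u v" using h_add gS hg by simp
      then have "g (aadd ?M u v) = aadd ?Q (g u) (g v)" using gh[of "aadd ?Q (g u) (g v)"] kS(2) gS C by simp
      moreover have "aadd ?M u v \<in> acarrier ?M" using C by (simp add: mat_alg_def)
      ultimately show ?case using kspan_add.IH kspan.kspan_add by metis
    next
      case (kspan_smul u c)
      then have C: "u \<in> acarrier ?M" by blast
      then have "h (asmul ?Q c (g u)) = asmul ?M c u" using h_smul gS hg by simp
      then have "g (asmul ?M c u) = asmul ?Q c (g u)" using gh[of "asmul ?Q c (g u)"] kS(5) gS C by simp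
      moreover have "asmul ?M c u \<in> acarrier ?M" using C by (simp add: mat_alg_def)
      ultimately show ?case using kspan_smul.IH kspan.kspan_smul by metis
    qed
    moreover have "h (kcoset R J f) \<in> acarrier ?M" using S(2) f bij by (auto simp: bij_betw_def)
    ultimately have "g (h (kcoset R J f)) \<in> kspan ?Q ?V" using mat_alg_kspan by blast
    then have "kcoset R J f \<in> kspan ?Q ?V" using gh S(2) f by auto
    moreover have "(case i of (p, p') \<Rightarrow> X p p') \<in> acarrier ?Q" if "i \<in> same_block P fst" for i
      using that XS SQ by (cases i) auto
    ultimately obtain w where w: "w \<in> kspan R ((\<lambda>i. SOME y. y \<in> (case i of (p, p') \<Rightarrow> X p p')) ` same_block P fst)"
        "kcoset R J f = kcoset R J w"
      using quot_kspan[of "same_block P fst" "\<lambda>(p, p'). X p p'"] by blast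
    have "(\<lambda>i. SOME y. y \<in> (case i of (p, p') \<Rightarrow> X p p')) = (\<lambda>(p, p'). x p p')"
      by (auto simp: x_def fun_eq_iff)
    then have "w \<in> kspan R ((\<lambda>(p, p'). x p p') ` same_block P fst)" using w(1) by (simp only:)
    then show ?thesis using kcoset_eqD[OF _ w(2)] f F(2) by blast
  qed
  ultimately show ?thesis using x(1) by (intro exI[of _ P] exI[of _ x]) blast
qed

end

section \<open>Transfer along an embedding\<close>

lemma subalgebra_is_kalg:
  assumes "is_kalg A" "kalg_subalgebra S A"
  shows "is_kalg (A\<lparr>acarrier := S\<rparr>)"
proof -
  have S: "S \<subseteq> acarrier A" "azero A \<in> S" "\<forall>x\<in>S. \<forall>y\<in>S. aadd A x y \<in> S \<and> amul A x y \<in> S"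
    "\<forall>x\<in>S. aneg A x \<in> S" "\<forall>c. \<forall>x\<in>S. asmul A c x \<in> S"
    using assms(2) by (auto simp: kalg_subalgebra_def)
  note k = is_kalgD[OF assms(1)]
  have upd: "acarrier (A\<lparr>acarrier := S\<rparr>) = S" "azero (A\<lparr>acarrier := S\<rparr>) = azero A"
    "aadd (A\<lparr>acarrier := S\<rparr>) = aadd A" "aneg (A\<lparr>acarrier := S\<rparr>) = aneg A"
    "amul (A\<lparr>acarrier := S\<rparr>) = amul A" "asmul (A\<lparr>acarrier := S\<rparr>) = asmul A" by simp_all
  show ?thesis
    unfolding is_kalg_def Let_def upd
    by (intro conjI ballI allI; ((use S(2-5) in blast) | (rule k(6-18); erule subsetD[OF S(1)])))
qed

section \<open>Images and preimages of subalgebras\<close>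

locale embedded_kalg =
  fixes R :: "('k::field, 'a) kalg" and \<phi> :: "'a \<Rightarrow> ('i, 'k) lin_endo"
  assumes R: "is_kalg R" and inj: "inj_on \<phi> (acarrier R)"
    and add: "\<lbrakk>x \<in> acarrier R; y \<in> acarrier R\<rbrakk> \<Longrightarrow> \<phi> (aadd R x y) = \<phi> x + \<phi> y"
    and mul: "\<lbrakk>x \<in> acarrier R; y \<in> acarrier R\<rbrakk> \<Longrightarrow> \<phi> (amul R x y) = \<phi> x * \<phi> y"
    and smul: "x \<in> acarrier R \<Longrightarrow> \<phi> (asmul R c x) = endo_scale c (\<phi> x)"
begin

lemmas R_closed = is_kalgD(1-5)[OF R]

lemma zero: "\<phi> (azero R) = 0"
  using add[OF R_closed(1) R_closed(1)] is_kalgD(11)[OF R R_closed(1)] by simp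

lemma neg: "x \<in> acarrier R \<Longrightarrow> \<phi> (aneg R x) = - \<phi> x"
  using add[OF R_closed(4), of x x] is_kalgD(12)[OF R, of x] zero by (simp add: eq_neg_iff_add_eq_0)

lemma eq_zeroI: "x \<in> acarrier R \<Longrightarrow> \<phi> x = 0 \<Longrightarrow> x = azero R"
  using inj_onD[OF inj, of x "azero R"] zero R_closed(1) by simp

lemma image_subalg:
  assumes "kalg_subalgebra S R"
  shows "endo.subalg (\<phi> ` S)"
proof -
  have S: "S \<subseteq> acarrier R" "azero R \<in> S" "\<And>x y. x \<in> S \<Longrightarrow> y \<in> S \<Longrightarrow> aadd R x y \<in> S"
    "\<And>x y. x \<in> S \<Longrightarrow> y \<in> S \<Longrightarrow> amul R x y \<in> S" "\<And>c x. x \<in> S \<Longrightarrow> asmul R c x \<in> S"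
    using assms by (auto simp: kalg_subalgebra_def)
  have "0 \<in> \<phi> ` S" using S(2) zero by (metis imageI)
  moreover have "\<phi> x + \<phi> y \<in> \<phi> ` S" if "x \<in> S" "y \<in> S" for x y
    by (rule image_eqI[of _ _ "aadd R x y"]) (use that S in \<open>auto simp: add subsetD\<close>)
  moreover have "\<phi> x * \<phi> y \<in> \<phi> ` S" if "x \<in> S" "y \<in> S" for x y
    by (rule image_eqI[of _ _ "amul R x y"]) (use that S in \<open>auto simp: mul subsetD\<close>)
  moreover have "endo_scale c (\<phi> x) \<in> \<phi> ` S" if "x \<in> S" for c x
    by (rule image_eqI[of _ _ "asmul R c x"]) (use that S in \<open>auto simp: smul subsetD\<close>)
  ultimately show ?thesis unfolding endo.subalg_def endo.subspace_def by blast
qed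

text \<open>\<open>kspan\<close> consults the operations only, so the carrier \<open>S\<close> is
  left arbitrary and the statement serves both \<open>R\<close> and its subalgebras.\<close>

lemma image_kspan:
  assumes "B \<subseteq> acarrier R" "x \<in> kspan (R\<lparr>acarrier := S\<rparr>) B"
  shows "x \<in> acarrier R \<and> \<phi> x \<in> endo.span (\<phi> ` B)"
  using assms(2)
proof induction
  case (kspan_gen b)
  then show ?case using assms(1) by (auto intro: endo.span_base)
qed (auto simp: R_closed zero add smul endo.span_zero endo.span_add endo.span_scale)

lemma fdss_image_vn_regular:
  assumes S: "kalg_subalgebra S R" and fdss: "fdss (R\<lparr>acarrier := S\<rparr>)"
  shows "endo.findim (\<phi> ` S)" "vn_regular (\<phi> ` S)"
proof -
  have SR: "S \<subseteq> acarrier R" using S by (simp add: kalg_subalgebra_def)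
  obtain B where B: "finite B" "B \<subseteq> S" "S \<subseteq> kspan (R\<lparr>acarrier := S\<rparr>) B"
    using fdss unfolding fdss_def fin_dim_def by auto
  have "\<phi> ` S \<subseteq> endo.span (\<phi> ` B)" using image_kspan[of B _ S] B SR by blast
  then show fd: "endo.findim (\<phi> ` S)" using B(1) unfolding endo.findim_def by blast
  have "endo.radical_free (\<phi> ` S)"
    unfolding endo.radical_free_def
  proof (intro ballI impI)
    fix a assume a: "a \<in> \<phi> ` S" "\<forall>r\<in>\<phi> ` S. \<exists>b\<in>\<phi> ` S. b + r * a + b * (r * a) = 0"
    then obtain x where x: "x \<in> S" "a = \<phi> x" by blast
    have "\<exists>b\<in>S. aadd R (aadd R b (amul R r x)) (amul R b (amul R r x)) = azero R" if r: "r \<in> S" for r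
    proof -
      obtain b where b: "b \<in> S" "\<phi> b + \<phi> r * \<phi> x + \<phi> b * (\<phi> r * \<phi> x) = 0" using a(2) r x by blast
      have C: "b \<in> acarrier R" "r \<in> acarrier R" "x \<in> acarrier R" using b r x SR by auto
      then have "\<phi> (aadd R (aadd R b (amul R r x)) (amul R b (amul R r x))) = 0"
        using b(2) by (simp add: add mul R_closed)
      then show ?thesis
        by (intro bexI[OF _ b(1)] eq_zeroI) (use C in \<open>simp_all add: R_closed\<close>)
    qed
    then have "x \<in> jacobson_rad (R\<lparr>acarrier := S\<rparr>)"
      using x(1) by (simp add: jacobson_rad_def left_qr_def)
    then show "a = 0" using fdss zero x(2) by (simp add: fdss_def)
  qed
  then show "vn_regular (\<phi> ` S)"
    using endo.radical_free_imp_vn_regular[OF image_subalg[OF S] fd] by blast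
qed

text \<open>Regularity kills the radical: if \<open>a * y * a = a\<close>, then \<open>y * a\<close>
  is an idempotent, and left quasi-regularity of \<open>- (y * a)\<close> forces it to be zero,
  hence also \<open>a\<close>.\<close>

lemma preimage_fdss:
  assumes T: "endo.subalg T" "endo.findim T" "vn_regular T" "T \<subseteq> \<phi> ` acarrier R"
  defines "S \<equiv> {x \<in> acarrier R. \<phi> x \<in> T}"
  shows "kalg_subalgebra S R" "fdss (R\<lparr>acarrier := S\<rparr>)"
proof -
  have SR: "S \<subseteq> acarrier R" by (auto simp: S_def)
  show sub: "kalg_subalgebra S R"
    unfolding kalg_subalgebra_def S_def
    using T(1) by (auto simp: R_closed zero add mul smul neg endo.subalg_closed)
  let ?A = "R\<lparr>acarrier := S\<rparr>"
  have kalg: "is_kalg ?A" using subalgebra_is_kalg[OF R sub] .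
  have "fin_dim ?A"
  proof -
    \<comment> \<open>The finite spanning set provided by \<open>endo.findim\<close> may lie outside
      \<open>T\<close>; a basis inside \<open>T\<close> is needed to pull generators back along
      \<open>\<phi>\<close>.\<close>
    obtain C where C: "C \<subseteq> T" "endo.independent C" "T \<subseteq> endo.span C"
      by (rule endo.maximal_independent_subset)
    obtain D where D: "finite D" "T \<subseteq> endo.span D" using T(2) by (auto simp: endo.findim_def)
    have "finite C" using endo.independent_span_bound[OF D(1) C(2)] C(1) D(2) by blast
    define B where "B = {x \<in> S. \<phi> x \<in> C}"
    have "finite B"
    proof (rule finite_imageD)
      show "finite (\<phi> ` B)" by (rule finite_subset[OF _ \<open>finite C\<close>]) (auto simp: B_def)
      show "inj_on \<phi> B" by (rule inj_on_subset[OF inj]) (use SR in \<open>auto simp: B_def\<close>)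
    qed
    moreover have "x \<in> kspan ?A B" if "x \<in> S" for x
    proof -
      have "\<phi> x \<in> endo.span C" using that C(3) by (auto simp: S_def)
      then have "\<exists>y\<in>kspan ?A B. y \<in> acarrier R \<and> \<phi> y = \<phi> x"
      proof (induction rule: endo.span_induct_alt)
        case base
        have "azero ?A \<in> kspan ?A B" by (rule kspan_zero)
        then show ?case using R_closed(1) zero by auto
      next
        case (step c u v)
        then obtain y where y: "y \<in> kspan ?A B" "y \<in> acarrier R" "\<phi> y = v" by blast
        obtain b where b: "b \<in> acarrier R" "\<phi> b = u" using step(1) C(1) T(4) by blast
        then have "b \<in> B" using step(1) C(1) by (auto simp: B_def S_def)
        then have "aadd ?A (asmul ?A c b) y \<in> kspan ?A B"
          by (rule kspan_add[OF kspan_smul[OF kspan_gen] y(1)])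
        then show ?case using y b by (intro bexI) (auto simp: add smul R_closed)
      qed
      then show ?thesis using inj_onD[OF inj] that SR by blast
    qed
    ultimately show ?thesis unfolding fin_dim_def by (intro exI[of _ B]) (auto simp: B_def)
  qed
  moreover have "jacobson_rad ?A = {azero ?A}"
  proof -
    have "azero R \<in> S" using sub by (simp add: kalg_subalgebra_def)
    have mul0: "amul R r (azero R) = azero R" if "r \<in> acarrier R" for r
      using that by (intro eq_zeroI) (simp_all add: mul zero R_closed)
    have "azero R \<in> jacobson_rad ?A"
      using \<open>azero R \<in> S\<close> SR
      by (auto simp: jacobson_rad_def left_qr_def mul0 subsetD R_closed is_kalgD(11)[OF R]
          intro!: bexI[of _ "azero R"])
    moreover have "a = azero R" if rad: "a \<in> jacobson_rad ?A" for a
    proof -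
      have a: "a \<in> S" using rad by (simp add: jacobson_rad_def)
      then obtain y where y: "y \<in> S" "\<phi> a * \<phi> y * \<phi> a = \<phi> a"
        using T(3,4) unfolding vn_regular_def S_def by blast
      have "aneg R y \<in> S" using y sub by (simp add: kalg_subalgebra_def)
      then obtain b where b: "b \<in> S" "aadd R (aadd R b (amul R (aneg R y) a)) (amul R b (amul R (aneg R y) a)) = azero R"
        using rad by (auto simp: jacobson_rad_def left_qr_def)
      define e where "e = \<phi> y * \<phi> a"
      have C: "a \<in> acarrier R" "y \<in> acarrier R" "b \<in> acarrier R" using a y b SR by auto
      have "\<phi> b - e - \<phi> b * e = 0"
        using arg_cong[OF b(2), of \<phi>] C by (simp add: add mul neg zero R_closed e_def)
      moreover have "e * e = e" unfolding e_def using y(2) by (simp add: mult.assoc)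
      then have "(\<phi> b - e - \<phi> b * e) * e = - e" by (simp add: left_diff_distrib mult.assoc)
      ultimately have "e = 0" by simp
      then have "\<phi> a = 0" using y(2) by (simp add: mult.assoc e_def)
      then show ?thesis using eq_zeroI C by blast
    qed
    ultimately have "jacobson_rad ?A = {azero R}" by blast
    then show ?thesis by simp
  qed
  ultimately show "fdss ?A" using kalg by (simp add: fdss_def)
qed

end

theorem theorem4p10:
  fixes R :: "('k::field, 'a) kalg" and J :: "'a set"
  assumes "is_kalg R"
    and "kalg_ideal J R"
    and "locally_fdss (R\<lparr>acarrier := J\<rparr>)"
    and "locally_matricial (quot_alg R J)"
  shows "locally_fdss R"
proof -
  obtain \<phi> :: "'a \<Rightarrow> ('a option, 'k) lin_endo" where \<phi>: "inj_on \<phi> (acarrier R)"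
      "\<forall>x\<in>acarrier R. \<forall>y\<in>acarrier R. \<phi> (aadd R x y) = \<phi> x + \<phi> y \<and> \<phi> (amul R x y) = \<phi> x * \<phi> y"
      "\<forall>c. \<forall>x\<in>acarrier R. \<phi> (asmul R c x) = endo_scale c (\<phi> x)"
    using kalg_embedding[OF assms(1)] by blast
  interpret embedded_kalg R \<phi>
    by unfold_locales (simp_all add: assms(1) \<phi>)
  note J_closed = ideal_closed[OF assms(1,2)]
  have J_sub: "kalg_subalgebra J R"
    using assms(2) by (auto simp: kalg_subalgebra_def kalg_ideal_def)
  note J_alg = image_subalg[OF J_sub]
  have J_local: "\<exists>T. endo.subalg T \<and> T \<subseteq> \<phi> ` J \<and> F \<subseteq> T \<and> endo.findim T \<and> vn_regular T"
    if F: "finite F" "F \<subseteq> \<phi> ` J" for F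
  proof -
    obtain F0 where F0: "F0 \<subseteq> J" "finite F0" "F = \<phi> ` F0"
      using finite_subset_image[OF F] by blast
    then obtain S where S: "kalg_subalgebra S (R\<lparr>acarrier := J\<rparr>)" "F0 \<subseteq> S" "fdss (R\<lparr>acarrier := S\<rparr>)"
      using assms(3) unfolding locally_fdss_def by auto
    have SJ: "S \<subseteq> J" using S(1) by (simp add: kalg_subalgebra_def)
    have sub: "kalg_subalgebra S R" using S(1) J_closed(1) by (auto simp: kalg_subalgebra_def)
    show ?thesis
      using image_subalg[OF sub] fdss_image_vn_regular[OF sub S(3)] F0(3) S(2) SJ
      by (intro exI[of _ "\<phi> ` S"]) (simp add: image_mono)
  qed
  show ?thesis
    unfolding locally_fdss_def
  proof (intro allI impI)
    fix F assume F: "finite F \<and> F \<subseteq> acarrier R"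
    from quotient_matrix_units[OF assms(1,2,4) conjunct1[OF F] conjunct2[OF F]]
    obtain P :: "(nat \<times> nat) set" and x where P: "finite P"
      and x: "\<forall>(p, p')\<in>same_block P fst. x p p' \<in> acarrier R"
      and xx: "\<forall>(p, p')\<in>same_block P fst. \<forall>(s, t)\<in>same_block P fst.
         \<exists>j\<in>J. amul R (x p p') (x s t) = aadd R (if p' = s then x p t else azero R) j"
      and Fx: "\<forall>f\<in>F. \<exists>w\<in>kspan R ((\<lambda>(p, p'). x p p') ` same_block P fst). \<exists>j\<in>J. f = aadd R w j"
      by (elim exE conjE) (rule that)
    have xR: "x p p' \<in> acarrier R" if "p \<in> P" "p' \<in> P" "fst p = fst p'" for p p'
      using bspec[OF x, of "(p, p')"] that by (simp add: same_block_def)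
    define y where "y p p' = \<phi> (x p p')" for p p'
    have y_img: "(\<lambda>(p, p'). y p p') ` same_block P fst = \<phi> ` (\<lambda>(p, p'). x p p') ` same_block P fst"
      by (auto simp: y_def image_image split_beta)
    have V: "(\<lambda>(p, p'). x p p') ` same_block P fst \<subseteq> acarrier R" using x by auto
    have "\<exists>T. endo.subalg T \<and> endo.findim T \<and> vn_regular T \<and> \<phi> ` F \<subseteq> T
      \<and> (\<forall>s\<in>T. \<exists>w\<in>endo.span ((\<lambda>(p, p'). y p p') ` same_block P fst). s - w \<in> \<phi> ` J)"
    proof (rule endo.extension_local_subalgebra[OF J_alg J_local P])
      show "matrix_units_mod (\<phi> ` J) P fst y"
        unfolding matrix_units_mod_def
      proof (intro ballI impI)
        fix p p' s t assume pst: "p \<in> P" "p' \<in> P" "s \<in> P" "t \<in> P" "fst p = fst p'" "fst s = fst t"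
        then have "(p, p') \<in> same_block P fst" "(s, t) \<in> same_block P fst" by (simp_all add: same_block_def)
        then obtain j where j: "j \<in> J" "amul R (x p p') (x s t) = aadd R (if p' = s then x p t else azero R) j"
          using xx by blast
        have "(if p' = s then x p t else azero R) \<in> acarrier R" using pst xR R_closed(1) by auto
        then have "y p p' * y s t = \<phi> (if p' = s then x p t else azero R) + \<phi> j"
          using arg_cong[OF j(2), of \<phi>] pst xR j(1) J_closed(1) by (auto simp: y_def mul add)
        then have "y p p' * y s t - (if p' = s then y p t else 0) = \<phi> j"
          by (auto simp: y_def zero)
        then show "y p p' * y s t - (if p' = s then y p t else 0) \<in> \<phi> ` J" using j(1) by simp
      qed
      show "\<forall>p\<in>P. \<forall>p'\<in>P. fst p = fst p' \<longrightarrow> y p p' \<in> idealizer (\<phi> ` J)"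
      proof (intro ballI impI)
        fix p p' assume pp: "p \<in> P" "p' \<in> P" "fst p = fst p'"
        have "\<phi> (x p p') * \<phi> j \<in> \<phi> ` J \<and> \<phi> j * \<phi> (x p p') \<in> \<phi> ` J" if "j \<in> J" for j
          using that xR[OF pp] J_closed(1) J_closed(6,7)[OF xR[OF pp] that]
            mul[of "x p p'" j, symmetric] mul[of j "x p p'", symmetric] by auto
        then show "y p p' \<in> idealizer (\<phi> ` J)" by (auto simp: idealizer_def y_def)
      qed
      show "\<forall>f\<in>\<phi> ` F. \<exists>w\<in>endo.span ((\<lambda>(p, p'). y p p') ` same_block P fst). f - w \<in> \<phi> ` J"
      proof clarify
        fix f assume "f \<in> F"
        then obtain w j where w: "w \<in> kspan R ((\<lambda>(p, p'). x p p') ` same_block P fst)" and j: "j \<in> J" "f = aadd R w j"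
          using Fx by blast
        have "w \<in> acarrier R" "\<phi> w \<in> endo.span ((\<lambda>(p, p'). y p p') ` same_block P fst)"
          using image_kspan[OF V, of w "acarrier R"] w unfolding y_img by auto
        moreover from this have "\<phi> f - \<phi> w = \<phi> j" using j J_closed(1) by (auto simp: add)
        ultimately show "\<exists>w\<in>endo.span ((\<lambda>(p, p'). y p p') ` same_block P fst). \<phi> f - w \<in> \<phi> ` J"
          using j(1) by (intro bexI[of _ "\<phi> w"]) auto
      qed
    qed (use F in auto)
    then obtain T where T: "endo.subalg T" "endo.findim T" "vn_regular T" "\<phi> ` F \<subseteq> T"
      "\<forall>s\<in>T. \<exists>w\<in>endo.span ((\<lambda>(p, p'). y p p') ` same_block P fst). s - w \<in> \<phi> ` J" by blast
    have R_sub: "kalg_subalgebra (acarrier R) R" using R_closed by (simp add: kalg_subalgebra_def)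
    have R_img: "endo.subspace (\<phi> ` acarrier R)"
      using image_subalg[OF R_sub] by (simp add: endo.subalg_def)
    have span_R: "endo.span ((\<lambda>(p, p'). y p p') ` same_block P fst) \<subseteq> \<phi> ` acarrier R"
      unfolding y_img using V R_img by (intro endo.span_minimal) auto
    \<comment> \<open>Each element is congruent modulo the image of \<open>J\<close> to a
      combination of the \<open>y p p'\<close>, and both summands come from
      \<open>R\<close>.\<close>
    have "T \<subseteq> \<phi> ` acarrier R"
    proof
      fix s assume "s \<in> T"
      then obtain w where w: "w \<in> \<phi> ` acarrier R" "s - w \<in> \<phi> ` acarrier R"
        using T(5) span_R J_closed(1) by blast
      then show "s \<in> \<phi> ` acarrier R" using endo.subspace_add[OF R_img w(2) w(1)] by simp
    qed
    then show "\<exists>S. kalg_subalgebra S R \<and> F \<subseteq> S \<and> fdss (R\<lparr>acarrier := S\<rparr>)"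
      using preimage_fdss[OF T(1-3)] T(4) F by (intro exI[of _ "{x \<in> acarrier R. \<phi> x \<in> T}"]) auto
  qed
qed

end
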